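(* Let $0\le k\le\infty$. If $K$ is a countable subset of $\mathcal R^{k}_{\ge 0}(\mathbb R^2)$ and $X$ is a separable metrizable space, then for any distinct points $x_1,x_2\in X$ and any distinct metrics $g_1,g_2$ in $\mathcal R^{k}_{\ge 0}(\mathbb R^2)\smallsetminus K$ there is an embedding (a homeomorphism onto its image) of $X$ into $\mathcal R^{k}_{\ge 0}(\mathbb R^2)\smallsetminus K$ that takes $x_1,x_2$ to $g_1,g_2$, respectively.
   Context: For $k$ an integer with $k\ge 0$ or $k=\infty$, $\mathcal R^{k}_{\ge 0}(\mathbb R^2)$ denotes the set of all $C^\infty$ complete Riemannian metrics on $\mathbb R^2$ of nonnegative sectional curvature, equipped with the $C^k$ topology, i.e. the topology of $C^k$ uniform convergence on compact sets (uniform convergence on compact sets of the metric coefficients and their partial derivatives of order $\le k$; of all orders if $k=\infty$). Subsets carry the subspace topology. *)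

theory Defs
  imports "HOL-Analysis.Analysis" "HOL-Library.Extended_Nat"
begin

section \<open>Partial derivatives and smooth functions\<close>

definition partial_deriv :: "'n \<Rightarrow> (real ^ 'n \<Rightarrow> real) \<Rightarrow> real ^ 'n \<Rightarrow> real"
  where "partial_deriv i f x = deriv (\<lambda>t. f (x + t *\<^sub>R axis i 1)) 0"

definition iter_partial :: "'n list \<Rightarrow> (real ^ 'n \<Rightarrow> real) \<Rightarrow> real ^ 'n \<Rightarrow> real"
  where "iter_partial is f = foldr partial_deriv is f"

text \<open>Differentiability of a partial derivative gives its continuity, so this is exactly
  the existence and continuity of the partial derivatives of all orders.\<close>

definition smooth_function :: "(real ^ 'n \<Rightarrow> real) \<Rightarrow> bool"
  where "smooth_function f \<longleftrightarrow> (\<forall>is. iter_partial is f differentiable_on UNIV)"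


section \<open>Riemannian metrics on Euclidean space\<close>

text \<open>A metric is given by the matrix of its coefficients in the standard global chart.\<close>

type_synonym 'n metric_field = "real ^ 'n \<Rightarrow> real ^ 'n ^ 'n"

definition metric_inner :: "'n::finite metric_field \<Rightarrow> real ^ 'n \<Rightarrow> real ^ 'n \<Rightarrow> real ^ 'n \<Rightarrow> real"
  where "metric_inner g x u v = u \<bullet> (g x *v v)"

definition riemannian_metric :: "'n::finite metric_field \<Rightarrow> bool"
  where "riemannian_metric g \<longleftrightarrow>
    (\<forall>i j. smooth_function (\<lambda>x. g x $ i $ j)) \<and>
    (\<forall>x u v. metric_inner g x u v = metric_inner g x v u) \<and>
    (\<forall>x v. v \<noteq> 0 \<longrightarrow> metric_inner g x v v > 0)"

text \<open>The predicate \<open>valid_path\<close> lets the derivative be unbounded near the finitely many exceptional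
  parameters, so a valid path may have infinite length, in which case \<open>integral\<close> would return the
  junk value 0. Hence the length is required to exist through \<open>has_integral\<close>. The admitted paths
  include all piecewise continuously differentiable paths in the usual sense and are absolutely
  continuous, so the infimum is the usual Riemannian distance.\<close>

definition riem_dist :: "'n::finite metric_field \<Rightarrow> real ^ 'n \<Rightarrow> real ^ 'n \<Rightarrow> real"
  where "riem_dist g x y = Inf {l. \<exists>\<gamma>. valid_path \<gamma> \<and> pathstart \<gamma> = x \<and> pathfinish \<gamma> = y \<and>
    ((\<lambda>t. sqrt (metric_inner g (\<gamma> t) (vector_derivative \<gamma> (at t)) (vector_derivative \<gamma> (at t))))
      has_integral l) {0..1}}"

definition complete_metric :: "'n::finite metric_field \<Rightarrow> bool"
  where "complete_metric g \<longleftrightarrow> Metric_space.mcomplete UNIV (riem_dist g)"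


section \<open>Curvature\<close>

text \<open>Coefficient \<open>\<Gamma>\<^sup>k\<^sub>i\<^sub>j\<close> of the Levi-Civita connection.\<close>

definition christoffel :: "'n::finite metric_field \<Rightarrow> 'n \<Rightarrow> 'n \<Rightarrow> 'n \<Rightarrow> real ^ 'n \<Rightarrow> real"
  where "christoffel g k i j x = 1/2 * (\<Sum>l\<in>UNIV. matrix_inv (g x) $ k $ l *
     (partial_deriv i (\<lambda>y. g y $ j $ l) x + partial_deriv j (\<lambda>y. g y $ i $ l) x
       - partial_deriv l (\<lambda>y. g y $ i $ j) x))"

text \<open>Component \<open>l\<close> of \<open>R(\<partial>\<^sub>i, \<partial>\<^sub>j) \<partial>\<^sub>k\<close>, with the sign convention
  \<open>R(u, v) w = \<nabla>\<^sub>u \<nabla>\<^sub>v w - \<nabla>\<^sub>v \<nabla>\<^sub>u w - \<nabla>\<^bsub>[u, v]\<^esub> w\<close>.\<close>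

definition curvature_coeff :: "'n::finite metric_field \<Rightarrow> 'n \<Rightarrow> 'n \<Rightarrow> 'n \<Rightarrow> 'n \<Rightarrow> real ^ 'n \<Rightarrow> real"
  where "curvature_coeff g l i j k x =
    partial_deriv i (christoffel g l j k) x - partial_deriv j (christoffel g l i k) x
    + (\<Sum>m\<in>UNIV. christoffel g m j k x * christoffel g l i m x
               - christoffel g m i k x * christoffel g l j m x)"

definition curvature_op ::
    "'n::finite metric_field \<Rightarrow> real ^ 'n \<Rightarrow> real ^ 'n \<Rightarrow> real ^ 'n \<Rightarrow> real ^ 'n \<Rightarrow> real ^ 'n"
  where "curvature_op g x u v w =
    (\<chi> l. \<Sum>i\<in>UNIV. \<Sum>j\<in>UNIV. \<Sum>k\<in>UNIV. curvature_coeff g l i j k x * u $ i * v $ j * w $ k)"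

definition sectional_curvature ::
    "'n::finite metric_field \<Rightarrow> real ^ 'n \<Rightarrow> real ^ 'n \<Rightarrow> real ^ 'n \<Rightarrow> real"
  where "sectional_curvature g x u v =
    metric_inner g x (curvature_op g x u v v) u /
    (metric_inner g x u u * metric_inner g x v v - (metric_inner g x u v)\<^sup>2)"

definition nonneg_curved :: "'n::finite metric_field \<Rightarrow> bool"
  where "nonneg_curved g \<longleftrightarrow>
    (\<forall>x u v. u \<noteq> v \<and> independent {u, v} \<longrightarrow> sectional_curvature g x u v \<ge> 0)"

definition complete_nonneg_metrics :: "'n::finite metric_field set"
  where "complete_nonneg_metrics = {g. riemannian_metric g \<and> complete_metric g \<and> nonneg_curved g}"


section \<open>The topology of \<open>C\<^sup>k\<close> uniform convergence on compact sets\<close>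

definition Ck_nbhd :: "'n::finite metric_field set \<Rightarrow> nat \<Rightarrow> (real ^ 'n) set \<Rightarrow> real \<Rightarrow>
    'n metric_field \<Rightarrow> 'n metric_field set"
  where "Ck_nbhd M N C e g = {h \<in> M. \<forall>x\<in>C. \<forall>i j is. length is \<le> N \<longrightarrow>
    \<bar>iter_partial is (\<lambda>y. h y $ i $ j) x - iter_partial is (\<lambda>y. g y $ i $ j) x\<bar> < e}"

definition Ck_topology :: "enat \<Rightarrow> 'n::finite metric_field set \<Rightarrow> 'n metric_field topology"
  where "Ck_topology k M = topology (\<lambda>U. U \<subseteq> M \<and>
    (\<forall>g\<in>U. \<exists>N C e. enat N \<le> k \<and> compact C \<and> e > 0 \<and> Ck_nbhd M N C e g \<subseteq> U))"

lemma Ck_nbhd_mono: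
  assumes "N \<le> N'" "C \<subseteq> C'" "e' \<le> e"
  shows "Ck_nbhd M N' C' e' g \<subseteq> Ck_nbhd M N C e g"
proof
  fix h assume h: "h \<in> Ck_nbhd M N' C' e' g"
  have "\<bar>iter_partial is (\<lambda>y. h y $ i $ j) x - iter_partial is (\<lambda>y. g y $ i $ j) x\<bar> < e"
    if "x \<in> C" "length is \<le> N" for x i j "is"
  proof -
    have "x \<in> C'" "length is \<le> N'"
      using assms that by (blast, linarith)
    then have "\<bar>iter_partial is (\<lambda>y. h y $ i $ j) x - iter_partial is (\<lambda>y. g y $ i $ j) x\<bar> < e'"
      using h unfolding Ck_nbhd_def mem_Collect_eq by blast
    then show ?thesis
      using assms(3) by (rule order_less_le_trans)
  qed
  moreover have "h \<in> M"
    using h unfolding Ck_nbhd_def mem_Collect_eq by (rule conjunct1)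
  ultimately show "h \<in> Ck_nbhd M N C e g"
    unfolding Ck_nbhd_def mem_Collect_eq by blast
qed

lemma openin_Ck_topology:
  "openin (Ck_topology k M) U \<longleftrightarrow> U \<subseteq> M \<and>
    (\<forall>g\<in>U. \<exists>N C e. enat N \<le> k \<and> compact C \<and> e > 0 \<and> Ck_nbhd M N C e g \<subseteq> U)"
proof -
  let ?Q = "\<lambda>U g. \<exists>N C e. enat N \<le> k \<and> compact C \<and> e > 0 \<and> Ck_nbhd M N C e g \<subseteq> U"
  have mono: "?Q V g" if "?Q U g" "U \<subseteq> V" for U V g
    using that by (meson order_trans)
  have inter: "?Q (S \<inter> T) g" if S: "?Q S g" and T: "?Q T g" for S T g
  proof -
    obtain N C e where 1: "enat N \<le> k" "compact C" "e > 0" "Ck_nbhd M N C e g \<subseteq> S"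
      using S by (elim exE conjE)
    obtain N' C' e' where 2: "enat N' \<le> k" "compact C'" "e' > 0" "Ck_nbhd M N' C' e' g \<subseteq> T"
      using T by (elim exE conjE)
    have "Ck_nbhd M (max N N') (C \<union> C') (min e e') g \<subseteq> S"
      by (rule order_trans[OF Ck_nbhd_mono 1(4)]) simp_all
    moreover have "Ck_nbhd M (max N N') (C \<union> C') (min e e') g \<subseteq> T"
      by (rule order_trans[OF Ck_nbhd_mono 2(4)]) simp_all
    moreover have "enat (max N N') \<le> k"
      using 1(1) 2(1) by (simp add: max_def)
    moreover have "compact (C \<union> C')" "min e e' > 0"
      using 1(2,3) 2(2,3) by (simp_all add: compact_Un)
    ultimately show ?thesis
      by (intro exI[of _ "max N N'"] exI[of _ "C \<union> C'"] exI[of _ "min e e'"] conjI Int_greatest)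
  qed
  have "istopology (\<lambda>U. U \<subseteq> M \<and> (\<forall>g\<in>U. ?Q U g))"
    unfolding istopology_def
  proof (intro conjI allI impI)
    fix S T
    assume S: "S \<subseteq> M \<and> (\<forall>g\<in>S. ?Q S g)" and T: "T \<subseteq> M \<and> (\<forall>g\<in>T. ?Q T g)"
    show "S \<inter> T \<subseteq> M"
      by (rule order_trans[OF Int_lower1 S[THEN conjunct1]])
    show "\<forall>g\<in>S \<inter> T. ?Q (S \<inter> T) g"
      by (intro ballI inter S[THEN conjunct2, rule_format] T[THEN conjunct2, rule_format])
        (simp_all only: Int_iff)
  next
    fix \<K>
    assume K: "\<forall>S\<in>\<K>. S \<subseteq> M \<and> (\<forall>g\<in>S. ?Q S g)"
    show "\<Union>\<K> \<subseteq> M"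
      by (rule Union_least) (rule K[rule_format, THEN conjunct1])
    show "\<forall>g\<in>\<Union>\<K>. ?Q (\<Union>\<K>) g"
    proof
      fix g assume "g \<in> \<Union>\<K>"
      then obtain S where S: "S \<in> \<K>" "g \<in> S"
        by (rule UnionE)
      have "?Q S g"
        by (rule K[rule_format, OF S(1), THEN conjunct2, rule_format, OF S(2)])
      then show "?Q (\<Union>\<K>) g"
        by (rule mono[OF _ Union_upper[OF S(1)]])
    qed
  qed
  then show ?thesis
    unfolding Ck_topology_def by (simp only: topology_inverse')
qed

lemma topspace_Ck_topology [simp]: "topspace (Ck_topology k M) = M"
proof (rule antisym)
  show "topspace (Ck_topology k M) \<subseteq> M"
    using openin_topspace[of "Ck_topology k M"] unfolding openin_Ck_topology by (rule conjunct1)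
  have "openin (Ck_topology k M) M"
    unfolding openin_Ck_topology
  proof (intro conjI ballI order_refl)
    fix g
    have "Ck_nbhd M 0 {} 1 g \<subseteq> M"
      unfolding Ck_nbhd_def by (rule Collect_restrict)
    moreover have "enat 0 \<le> k"
      by (simp flip: zero_enat_def)
    ultimately show "\<exists>N C e. enat N \<le> k \<and> compact C \<and> e > 0 \<and> Ck_nbhd M N C e g \<subseteq> M"
      by (intro exI[of _ 0] exI[of _ "{}"] exI[of _ 1] conjI compact_empty zero_less_one)
  qed
  then show "M \<subseteq> topspace (Ck_topology k M)"
    by (rule openin_subset)
qed

end

theory Submission
  imports Defs
begin

text \<open>Completeness and nonnegative curvature survive three elementary operations on a metric \<open>g\<close> of the
plane: multiplication by a positive constant, the zoom \<open>x \<mapsto> g (z + t (x - z))\<close> with \<open>t > 0\<close>, which is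
the pull-back under a homothety divided by \<open>t\<^sup>2\<close>, and pull-back under a shear
\<open>S\<^sub>h (x, y) = (x, y + h x)\<close>. As \<open>t\<close> tends to 0 the zoom converges, with all derivatives and uniformly
on compact sets, to the flat constant metric \<open>g z\<close>, and constant metrics form a convex set. So any two
metrics \<open>g1\<close>, \<open>g2\<close> are joined by a path: zoom into \<open>g1\<close> at \<open>z\<close>, move linearly from \<open>g1 z\<close> to
\<open>g2 z\<close>, zoom out of \<open>g2\<close>.

If \<open>g1 \<noteq> g2\<close>, then some vector \<open>v\<close> at some point \<open>z\<close> has different lengths in the two metrics; after
multiplication by a suitable positive factor the squared length of \<open>v\<close> is an affine nonconstant
function of the path parameter \<open>s\<close> (\<open>metric_path_value\<close>), hence \<open>s\<close> can be read off from the metric.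

The infinitely many remaining dimensions come from shears. Those with \<open>h (z $ 1) = 0\<close> act freely on
Riemannian metrics (\<open>sheared_metric_inject\<close>): if \<open>S\<^sub>h\<close> and \<open>S\<^sub>k\<close> pull a metric back to the same metric,
then \<open>h - k\<close> satisfies a first order differential inequality and vanishes identically once it has a
zero. If \<open>h\<close> also has vanishing derivative at \<open>z $ 1\<close>, the shear fixes \<open>z\<close> to first order and leaves the
squared length of \<open>v\<close> alone. Taking \<open>h\<close> to be a power series whose coefficients are the coordinates
of a point \<open>q\<close> of the Hilbert cube, multiplied by \<open>\<tau> (1 - \<tau>)\<close> where \<open>\<tau> q\<close> is the path parameter
assigned to \<open>q\<close>, gives a continuous injection of the cube through \<open>g1\<close> and \<open>g2\<close>; it is an embedding
because the cube is compact and the \<open>C\<^sup>k\<close> topology is Hausdorff.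

To avoid the countable set \<open>K\<close>, one coefficient is kept as a free parameter \<open>c \<in> [0, 1]\<close>. For different \<open>c\<close>
the images meet only in \<open>g1\<close> and \<open>g2\<close>, which lie outside \<open>K\<close>, so \<open>K\<close> meets only countably many of
them (\<open>hilbert_cube_embedding_avoiding\<close>). Finally, every separable metrizable space embeds into the
Hilbert cube.\<close>

section \<open>The Riemannian distance\<close>

definition speed :: "'n::finite metric_field \<Rightarrow> (real \<Rightarrow> real ^ 'n) \<Rightarrow> real \<Rightarrow> real"
  where "speed g \<gamma> t =
    sqrt (metric_inner g (\<gamma> t) (vector_derivative \<gamma> (at t)) (vector_derivative \<gamma> (at t)))"

definition lengths :: "'n::finite metric_field \<Rightarrow> real ^ 'n \<Rightarrow> real ^ 'n \<Rightarrow> real set"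
  where "lengths g x y = {l. \<exists>\<gamma>. valid_path \<gamma> \<and> pathstart \<gamma> = x \<and> pathfinish \<gamma> = y \<and>
    (speed g \<gamma> has_integral l) {0..1}}"

lemma riem_dist_eq_Inf_lengths: "riem_dist g x y = Inf (lengths g x y)"
  unfolding riem_dist_def lengths_def speed_def by (rule refl)

lemma metric_inner_scale: "metric_inner g x (c *\<^sub>R u) (c *\<^sub>R u) = c\<^sup>2 * metric_inner g x u u"
  by (simp add: metric_inner_def matrix_vector_mult_scaleR power2_eq_square)

lemma metric_inner_eq_sum: "metric_inner g x u v = (\<Sum>i\<in>UNIV. \<Sum>j\<in>UNIV. u $ i * (g x $ i $ j * v $ j))"
  by (simp add: metric_inner_def inner_vec_def matrix_vector_mult_def sum_distrib_left)

lemma smooth_function_continuous: "smooth_function f \<Longrightarrow> continuous_on S f"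
  by (metis continuous_on_subset differentiable_imp_continuous_on foldr.simps(1) id_apply iter_partial_def
      smooth_function_def subset_UNIV)

lemma riemannian_metric_continuous:
  "riemannian_metric g \<Longrightarrow> continuous_on S (\<lambda>x. g x $ i $ j)"
  unfolding riemannian_metric_def by (blast intro: smooth_function_continuous)

lemma riemannian_metric_symmetric: "riemannian_metric g \<Longrightarrow> metric_inner g x u v = metric_inner g x v u"
  unfolding riemannian_metric_def by blast

lemma riemannian_metric_pos: "riemannian_metric g \<Longrightarrow> v \<noteq> 0 \<Longrightarrow> metric_inner g x v v > 0"
  unfolding riemannian_metric_def by blast

lemma riemannian_metric_nonneg: "riemannian_metric g \<Longrightarrow> metric_inner g x v v \<ge> 0"
  by (cases "v = 0") (auto simp: metric_inner_def dest: riemannian_metric_pos[of g v x])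

lemma continuous_on_metric_inner:
  assumes "riemannian_metric g" "continuous_on S p" "continuous_on S u" "continuous_on S v"
  shows "continuous_on S (\<lambda>s. metric_inner g (p s) (u s) (v s))"
  unfolding metric_inner_eq_sum
  using assms
  by (intro continuous_intros continuous_on_compose2[OF riemannian_metric_continuous[OF assms(1), of UNIV]])
     auto

lemma valid_path_derivatives:
  assumes "valid_path \<gamma>"
  obtains S where "finite S" "continuous_on {0..1} \<gamma>"
    "\<And>t. t \<in> {0..1} - S \<Longrightarrow> (\<gamma> has_vector_derivative vector_derivative \<gamma> (at t)) (at t)"
    "continuous_on ({0..1} - S) (\<lambda>t. vector_derivative \<gamma> (at t))"
  using assms unfolding valid_path_def piecewise_C1_differentiable_on_def C1_differentiable_on_eq
  by (metis vector_derivative_works)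

lemma speed_transform:
  assumes "(\<gamma> has_vector_derivative D) (at t)"
  shows "speed g \<gamma> t = sqrt (metric_inner g (\<gamma> t) D D)"
  using vector_derivative_at[OF assms] by (simp add: speed_def)

text \<open>Speed dominates \<open>m\<close> times the Euclidean speed as long as the metric dominates \<open>m\<^sup>2\<close> times the Euclidean
metric. The bound is only asked for before a stopping time \<open>T\<close>, so that it can be applied up to the
first exit from a compact ball.\<close>

lemma length_ge_displacement:
  assumes g: "riemannian_metric g" and vp: "valid_path \<gamma>" and l: "(speed g \<gamma> has_integral l) {0..1}"
    and T: "0 \<le> T" "T \<le> 1" and m: "m > 0"
    and le: "\<And>t u. 0 \<le> t \<Longrightarrow> t < T \<Longrightarrow> m\<^sup>2 * (norm u)\<^sup>2 \<le> metric_inner g (\<gamma> t) u u"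
  shows "m * dist (\<gamma> 0) (\<gamma> T) \<le> l"
proof -
  obtain S where S: "finite S" "continuous_on {0..1} \<gamma>"
    "\<And>t. t \<in> {0..1} - S \<Longrightarrow> (\<gamma> has_vector_derivative vector_derivative \<gamma> (at t)) (at t)"
    "continuous_on ({0..1} - S) (\<lambda>t. vector_derivative \<gamma> (at t))"
    by (rule valid_path_derivatives[OF vp]) blast
  \<comment> \<open>The bound on the metric is not assumed at \<open>T\<close> itself, so \<open>T\<close> joins the exceptional set, on which both integrands are replaced by 0.\<close>
  let ?S = "insert T S"
  define f where "f t = (if t \<in> ?S then 0 else vector_derivative \<gamma> (at t))" for t
  define e where "e t = (if t \<in> ?S then 0 else speed g \<gamma> t)" for t
  have fi: "(f has_integral \<gamma> T - \<gamma> 0) {0..T}"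
  proof (rule fundamental_theorem_of_calculus_interior_strong[of ?S])
    show "(\<gamma> has_vector_derivative f t) (at t)" if "t \<in> {0<..<T} - ?S" for t
      using that S(3)[of t] T by (auto simp: f_def)
  qed (use S T in \<open>auto intro: continuous_on_subset\<close>)
  have ei: "(e has_integral l) {0..1}"
    by (rule has_integral_spike_finite[OF _ _ l, of ?S]) (auto simp: e_def S)
  have ei': "e integrable_on {0..T}"
    by (rule integrable_subinterval_real[of _ 0 1]) (use ei T in \<open>auto simp: integrable_on_def\<close>)
  have epos: "e t \<ge> 0" for t
    using riemannian_metric_nonneg[OF g] by (simp add: e_def speed_def)
  have "norm (\<gamma> T - \<gamma> 0) = norm (integral {0..T} f)"
    using fi by (simp add: integral_unique)
  also have "\<dots> \<le> integral {0..T} (\<lambda>t. e t / m)"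
  proof (rule integral_norm_bound_integral)
    show "f integrable_on {0..T}" using fi by (auto simp: integrable_on_def)
    show "(\<lambda>t. e t / m) integrable_on {0..T}"
      using ei' by (simp add: divide_inverse integrable_on_mult_left)
    fix t assume t: "t \<in> {0..T}"
    show "norm (f t) \<le> e t / m"
    proof (cases "t \<in> ?S")
      case False
      let ?u = "vector_derivative \<gamma> (at t)"
      have "m * norm ?u = sqrt (m\<^sup>2 * (norm ?u)\<^sup>2)"
        using m by (simp add: real_sqrt_mult)
      also have "\<dots> \<le> speed g \<gamma> t"
        unfolding speed_def using t False by (intro real_sqrt_le_mono le) auto
      finally show ?thesis using False m by (simp add: f_def e_def field_simps)
    qed (simp add: f_def e_def)
  qed
  also have "\<dots> = integral {0..T} e / m"
    by (simp add: divide_inverse)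
  also have "\<dots> \<le> integral {0..1} e / m"
    using m ei T ei' epos by (intro divide_right_mono integral_subset_le) (auto simp: integrable_on_def)
  also have "\<dots> = l / m" using ei by (simp add: integral_unique)
  finally show ?thesis using m by (simp add: dist_norm norm_minus_commute field_simps)
qed

lemma lengths_nonneg:
  assumes "riemannian_metric g" "l \<in> lengths g x y"
  shows "l \<ge> 0"
proof -
  obtain \<gamma> where "(speed g \<gamma> has_integral l) {0..1}"
    using assms unfolding lengths_def by blast
  then show ?thesis
    by (rule has_integral_nonneg) (simp add: speed_def riemannian_metric_nonneg[OF assms(1)])
qed

lemma bdd_below_lengths: "riemannian_metric g \<Longrightarrow> bdd_below (lengths g x y)"
  using lengths_nonneg by (metis bdd_below.I)

lemma line_length_in_lengths:
  assumes "riemannian_metric g"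
  shows "integral {0..1} (speed g (linepath x y)) \<in> lengths g x y"
proof -
  have "continuous_on {0..1} (speed g (linepath x y))"
    unfolding speed_def vector_derivative_linepath_at
    by (intro continuous_intros continuous_on_metric_inner assms)
  then have "(speed g (linepath x y) has_integral integral {0..1} (speed g (linepath x y))) {0..1}"
    by (intro integrable_integral integrable_continuous_real)
  then show ?thesis
    unfolding lengths_def by (intro CollectI exI[of _ "linepath x y"]) auto
qed

lemma lengths_nonempty: "riemannian_metric g \<Longrightarrow> lengths g x y \<noteq> {}"
  using line_length_in_lengths by blast

lemma lengths_reverse:
  assumes "l \<in> lengths g x y"
  shows "l \<in> lengths g y x"
proof -
  obtain \<gamma> where \<gamma>: "valid_path \<gamma>" "pathstart \<gamma> = x" "pathfinish \<gamma> = y" "(speed g \<gamma> has_integral l) {0..1}"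
    using assms unfolding lengths_def by blast
  obtain S where S: "finite S" "continuous_on {0..1} \<gamma>"
    "\<And>t. t \<in> {0..1} - S \<Longrightarrow> (\<gamma> has_vector_derivative vector_derivative \<gamma> (at t)) (at t)"
    "continuous_on ({0..1} - S) (\<lambda>t. vector_derivative \<gamma> (at t))"
    by (rule valid_path_derivatives[OF \<gamma>(1)]) blast
  have i: "((\<lambda>t. speed g \<gamma> (1 - t)) has_integral l) {0..1}"
    using has_integral_affinity01[OF \<gamma>(4), of "-1" 1] by simp
  have "(speed g (reversepath \<gamma>) has_integral l) {0..1}"
  proof (rule has_integral_spike_finite[OF _ _ i, of "(\<lambda>t. 1 - t) ` S"])
    fix t assume t: "t \<in> {0..1} - (\<lambda>t. 1 - t) ` S"
    have "1 - t \<notin> S" using t by (force simp: image_iff)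
    then have d: "(\<gamma> has_vector_derivative vector_derivative \<gamma> (at (1 - t))) (at (1 - t))"
      using S(3) t by auto
    have m: "((\<lambda>t. 1 - t) has_vector_derivative - 1) (at t)"
      by (auto intro!: derivative_eq_intros)
    have "(reversepath \<gamma> has_vector_derivative (-1) *\<^sub>R vector_derivative \<gamma> (at (1 - t))) (at t)"
      using vector_diff_chain_at[OF m d] by (simp add: reversepath_def[abs_def] o_def)
    from speed_transform[OF this, of g] show "speed g (reversepath \<gamma>) t = speed g \<gamma> (1 - t)"
      unfolding metric_inner_scale by (simp add: reversepath_def speed_def)
  qed (use S in auto)
  then show ?thesis
    unfolding lengths_def using \<gamma> by (intro CollectI exI[of _ "reversepath \<gamma>"]) simp
qed

lemma lengths_join:
  assumes g: "riemannian_metric g" and "l1 \<in> lengths g x y" "l2 \<in> lengths g y z"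
  shows "l1 + l2 \<in> lengths g x z"
proof -
  obtain p where p: "valid_path p" "pathstart p = x" "pathfinish p = y" "(speed g p has_integral l1) {0..1}"
    using assms unfolding lengths_def by blast
  obtain q where q: "valid_path q" "pathstart q = y" "pathfinish q = z" "(speed g q has_integral l2) {0..1}"
    using assms unfolding lengths_def by blast
  obtain S where S: "finite S" "continuous_on {0..1} p"
    "\<And>t. t \<in> {0..1} - S \<Longrightarrow> (p has_vector_derivative vector_derivative p (at t)) (at t)"
    "continuous_on ({0..1} - S) (\<lambda>t. vector_derivative p (at t))"
    by (rule valid_path_derivatives[OF p(1)]) blast
  obtain S' where S': "finite S'" "continuous_on {0..1} q"
    "\<And>t. t \<in> {0..1} - S' \<Longrightarrow> (q has_vector_derivative vector_derivative q (at t)) (at t)"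
    "continuous_on ({0..1} - S') (\<lambda>t. vector_derivative q (at t))"
    by (rule valid_path_derivatives[OF q(1)]) blast
  have i1: "((\<lambda>t. 2 * speed g p (2 * t)) has_integral l1) {0..1/2}"
   and i2: "((\<lambda>t. 2 * speed g q (2 * t - 1)) has_integral l2) {1/2..1}"
    using has_integral_affinity01 [OF p(4), where m= 2 and c=0, THEN has_integral_cmul [where c=2]]
          has_integral_affinity01 [OF q(4), where m= 2 and c="-1", THEN has_integral_cmul [where c=2]]
    by (simp_all only: image_affinity_atLeastAtMost_div_diff) simp_all
  have sc: "sqrt (metric_inner g a (2 *\<^sub>R u) (2 *\<^sub>R u)) = 2 * sqrt (metric_inner g a u u)" for a u
    by (simp add: metric_inner_scale real_sqrt_mult)
  have "(speed g (p +++ q) has_integral l1) {0..1/2}"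
  proof (rule has_integral_spike_finite[OF _ _ i1, of "insert (1/2) ((*) 2 -` S)"])
    show "finite (insert (1/2) ((*) 2 -` S))"
      using S by (force intro: finite_vimageI inj_onI)
    fix t :: real assume t: "t \<in> {0..1/2} - insert (1/2) ((*) 2 -` S)"
    have "((*) 2 has_vector_derivative 2) (at t)" by (auto intro!: derivative_eq_intros)
    moreover have "(p has_vector_derivative vector_derivative p (at (2 * t))) (at (2 * t))"
      using t by (intro S(3)) auto
    ultimately have "((\<lambda>t. p (2 * t)) has_vector_derivative 2 *\<^sub>R vector_derivative p (at (2 * t))) (at t)"
      by (intro vector_diff_chain_at [simplified o_def])
    then have "(p +++ q has_vector_derivative 2 *\<^sub>R vector_derivative p (at (2 * t))) (at t)"
      by (rule has_vector_derivative_transform_within_open[of _ _ _ "{..<1/2}"])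
         (use t in \<open>auto simp: joinpaths_def\<close>)
    from speed_transform[OF this, of g] show "speed g (p +++ q) t = 2 * speed g p (2 * t)"
      using t by (simp add: sc joinpaths_def speed_def)
  qed
  moreover have "(speed g (p +++ q) has_integral l2) {1/2..1}"
  proof (rule has_integral_spike_finite[OF _ _ i2, of "insert (1/2) ((\<lambda>t. 2 * t - 1) -` S')"])
    show "finite (insert (1/2) ((\<lambda>t. 2 * t - 1) -` S'))"
      using S' by (force intro: finite_vimageI inj_onI)
    fix t :: real assume t: "t \<in> {1/2..1} - insert (1/2) ((\<lambda>t. 2 * t - 1) -` S')"
    have "((\<lambda>t. 2 * t - 1) has_vector_derivative 2) (at t)" by (auto intro!: derivative_eq_intros)
    moreover have "(q has_vector_derivative vector_derivative q (at (2 * t - 1))) (at (2 * t - 1))"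
      using t by (intro S'(3)) auto
    ultimately have "((\<lambda>t. q (2 * t - 1)) has_vector_derivative 2 *\<^sub>R vector_derivative q (at (2 * t - 1))) (at t)"
      by (intro vector_diff_chain_at [simplified o_def])
    then have "(p +++ q has_vector_derivative 2 *\<^sub>R vector_derivative q (at (2 * t - 1))) (at t)"
      by (rule has_vector_derivative_transform_within_open[of _ _ _ "{1/2<..}"])
         (use t in \<open>auto simp: joinpaths_def\<close>)
    from speed_transform[OF this, of g] show "speed g (p +++ q) t = 2 * speed g q (2 * t - 1)"
      using t by (simp add: sc joinpaths_def speed_def)
  qed
  ultimately have "(speed g (p +++ q) has_integral l1 + l2) {0..1}"
    by (rule has_integral_combine[rotated 2]) auto
  moreover have "valid_path (p +++ q)" using p q by (intro valid_path_join) auto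
  ultimately show ?thesis
    unfolding lengths_def using p q by (intro CollectI exI[of _ "p +++ q"]) simp
qed

text \<open>On a closed ball the metric dominates a positive multiple of the Euclidean metric, by compactness of
the unit sphere bundle, and every path from \<open>x\<close> to \<open>y\<close> has to cross the ball of radius \<open>dist x y\<close> about \<open>x\<close>.\<close>

lemma riem_dist_pos:
  assumes g: "riemannian_metric g" and "x \<noteq> y"
  shows "riem_dist g x y > 0"
proof -
  let ?r = "dist x y"
  have r: "?r > 0" using assms by simp
  let ?K = "cball x ?r \<times> sphere (0::real^'a) 1"
  have c: "compact ?K" by (intro compact_Times) auto
  have "y \<in> cball x ?r" by simp
  moreover have "axis undefined 1 \<in> sphere (0::real^'a) 1" by simp
  ultimately have ne: "?K \<noteq> {}" by blast
  have co: "continuous_on ?K (\<lambda>p. metric_inner g (fst p) (snd p) (snd p))"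
    by (intro continuous_on_metric_inner g continuous_intros)
  obtain a where a: "a \<in> ?K"
    "\<And>p. p \<in> ?K \<Longrightarrow> metric_inner g (fst a) (snd a) (snd a) \<le> metric_inner g (fst p) (snd p) (snd p)"
    using continuous_attains_inf[OF c ne co] by blast
  define m where "m = sqrt (metric_inner g (fst a) (snd a) (snd a))"
  have "snd a \<noteq> 0" using a(1) by (auto simp: mem_Times_iff)
  then have m: "m > 0" unfolding m_def using riemannian_metric_pos[OF g] by simp
  have m2: "m\<^sup>2 * (norm u)\<^sup>2 \<le> metric_inner g p u u" if p: "p \<in> cball x ?r" for p u
  proof (cases "u = 0")
    case False
    have "(p, u /\<^sub>R norm u) \<in> ?K" using p False by simp
    from a(2)[OF this] have "m\<^sup>2 \<le> metric_inner g p (u /\<^sub>R norm u) (u /\<^sub>R norm u)"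
      unfolding m_def using riemannian_metric_nonneg[OF g] by simp
    then show ?thesis using False unfolding metric_inner_scale by (simp add: field_simps)
  qed (simp add: metric_inner_def)
  have "m * ?r \<le> l" if l: "l \<in> lengths g x y" for l
  proof -
    obtain \<gamma> where \<gamma>: "valid_path \<gamma>" "\<gamma> 0 = x" "\<gamma> 1 = y" "(speed g \<gamma> has_integral l) {0..1}"
      using l by (auto simp: lengths_def pathstart_def pathfinish_def)
    have co: "continuous_on {0..1} \<gamma>" using valid_path_imp_path[OF \<gamma>(1)] by (simp add: path_def)
    \<comment> \<open>\<open>T\<close> below is the first time at which the path has distance at least \<open>dist x y\<close> from \<open>x\<close>.\<close>
    let ?E = "{0..1} \<inter> (\<lambda>t. dist x (\<gamma> t)) -` {?r..}"
    have cl: "closed ?E"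
      by (intro continuous_closed_preimage continuous_on_dist continuous_on_const co) auto
    have comp: "compact ?E"
      using cl by (metis compact_Icc compact_Int_closed inf.absorb_iff2 inf_le1 inf_commute)
    have "1 \<in> ?E" using \<gamma> by auto
    then obtain T where T: "T \<in> ?E" "\<And>t. t \<in> ?E \<Longrightarrow> T \<le> t"
      using compact_attains_inf[OF comp] by blast
    have "\<gamma> t \<in> cball x ?r" if "0 \<le> t" "t < T" for t
      using T(1) T(2)[of t] that by (fastforce simp: not_le)
    then have "m * dist (\<gamma> 0) (\<gamma> T) \<le> l"
      using T(1) by (intro length_ge_displacement[OF g \<gamma>(1,4)] m m2) auto
    moreover have "?r \<le> dist (\<gamma> 0) (\<gamma> T)" using T(1) \<gamma> by auto
    ultimately show ?thesis using m by (smt (verit) mult_left_mono)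
  qed
  then have "m * ?r \<le> riem_dist g x y"
    unfolding riem_dist_eq_Inf_lengths by (intro cInf_greatest lengths_nonempty g)
  moreover have "m * ?r > 0" using m r by simp
  ultimately show ?thesis by linarith
qed

text \<open>Concatenation of paths gives the triangle inequality and reversal gives symmetry. Completeness refers to
this metric space structure, so every transport of completeness starts from here.\<close>

lemma Metric_space_riem_dist:
  assumes g: "riemannian_metric g"
  shows "Metric_space UNIV (riem_dist g)"
proof
  fix x y z
  show nn: "0 \<le> riem_dist g x y" for x y
    unfolding riem_dist_eq_Inf_lengths
    by (intro cInf_greatest lengths_nonempty g) (rule lengths_nonneg[OF g])
  show "riem_dist g x y = riem_dist g y x"
    unfolding riem_dist_eq_Inf_lengths using lengths_reverse by (metis subsetI subset_antisym)
  have "riem_dist g x x \<le> integral {0..1} (speed g (linepath x x))" for x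
    unfolding riem_dist_eq_Inf_lengths
    by (intro cInf_lower line_length_in_lengths bdd_below_lengths g)
  then have "riem_dist g x x = 0" for x
    using nn[of x x] by (intro antisym) (simp_all add: speed_def[abs_def] metric_inner_def)
  then show "(riem_dist g x y = 0) = (x = y)"
    using riem_dist_pos[OF g, of x y] by fastforce
  have "riem_dist g x z - l1 \<le> riem_dist g y z" if l1: "l1 \<in> lengths g x y" for l1
    unfolding riem_dist_eq_Inf_lengths
  proof (intro cInf_greatest lengths_nonempty g)
    fix l2 assume "l2 \<in> lengths g y z"
    then have "Inf (lengths g x z) \<le> l1 + l2"
      by (intro cInf_lower bdd_below_lengths g lengths_join[OF g l1])
    then show "Inf (lengths g x z) - l1 \<le> l2" by simp
  qed
  then have "riem_dist g x z - riem_dist g y z \<le> l1" if "l1 \<in> lengths g x y" for l1 using that by force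
  then have "riem_dist g x z - riem_dist g y z \<le> riem_dist g x y"
    unfolding riem_dist_eq_Inf_lengths[of g x y] by (intro cInf_greatest lengths_nonempty g)
  then show "riem_dist g x z \<le> riem_dist g x y + riem_dist g y z" by simp
qed

text \<open>The differential is required to be jointly continuous in base point and vector so that a piecewise
\<open>C\<^sup>1\<close> path is carried to a piecewise \<open>C\<^sup>1\<close> path.\<close>

lemma lengths_image:
  assumes \<psi>: "\<And>x. (\<psi> has_derivative D x) (at x)"
    and D: "continuous_on UNIV (\<lambda>(x, u). D x u)"
    and eq: "\<And>x u. metric_inner g' x u u = c * metric_inner g (\<psi> x) (D x u) (D x u)" and c: "c > 0"
    and l: "l \<in> lengths g' x y"
  shows "l / sqrt c \<in> lengths g (\<psi> x) (\<psi> y)"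
proof -
  obtain \<gamma> where \<gamma>: "valid_path \<gamma>" "pathstart \<gamma> = x" "pathfinish \<gamma> = y" "(speed g' \<gamma> has_integral l) {0..1}"
    using l unfolding lengths_def by blast
  obtain S where S: "finite S" "continuous_on {0..1} \<gamma>"
    "\<And>t. t \<in> {0..1} - S \<Longrightarrow> (\<gamma> has_vector_derivative vector_derivative \<gamma> (at t)) (at t)"
    "continuous_on ({0..1} - S) (\<lambda>t. vector_derivative \<gamma> (at t))"
    by (rule valid_path_derivatives[OF \<gamma>(1)]) blast
  have d: "(\<psi> \<circ> \<gamma> has_vector_derivative D (\<gamma> t) (vector_derivative \<gamma> (at t))) (at t)"
    if "t \<in> {0..1} - S" for t
    using vector_derivative_diff_chain_within[of \<gamma> _ t UNIV \<psi> "D (\<gamma> t)"] S(3)[OF that] \<psi>[of "\<gamma> t"]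
    by (simp add: has_derivative_at_withinI)
  have cD: "continuous_on ({0..1} - S) (\<lambda>t. D (\<gamma> t) (vector_derivative \<gamma> (at t)))"
  proof -
    have "continuous_on ({0..1} - S) (\<lambda>t. (\<gamma> t, vector_derivative \<gamma> (at t)))"
      by (intro continuous_intros S(4) continuous_on_subset[OF S(2)]) auto
    from continuous_on_compose2[OF D this] show ?thesis by auto
  qed
  have c\<psi>: "continuous_on UNIV \<psi>"
    using \<psi> by (meson continuous_at_imp_continuous_on has_derivative_continuous)
  have v: "valid_path (\<psi> \<circ> \<gamma>)"
    unfolding valid_path_def piecewise_C1_differentiable_on_def C1_differentiable_on_def
  proof (intro conjI exI)
    show "continuous_on {0..1} (\<psi> \<circ> \<gamma>)"
      by (intro continuous_on_compose S(2) continuous_on_subset[OF c\<psi>]) auto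
  qed (use S(1) d cD in auto)
  have "((\<lambda>t. speed g' \<gamma> t / sqrt c) has_integral l / sqrt c) {0..1}"
    by (intro has_integral_divide \<gamma>(4))
  then have "(speed g (\<psi> \<circ> \<gamma>) has_integral l / sqrt c) {0..1}"
  proof (rule has_integral_spike_finite[OF S(1), rotated])
    fix t assume t: "t \<in> {0..1} - S"
    show "speed g (\<psi> \<circ> \<gamma>) t = speed g' \<gamma> t / sqrt c"
      unfolding speed_transform[OF d[OF t]] using c
      by (simp add: speed_def eq real_sqrt_mult)
  qed
  then show ?thesis
    unfolding lengths_def using v \<gamma> by (auto simp: pathstart_compose pathfinish_compose)
qed

text \<open>The inverse map pulls \<open>g'\<close> back to \<open>1 / c\<close> times \<open>g\<close>, so the two sets of lengths correspond bijectively.\<close>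

lemma riem_dist_pullback:
  assumes g: "riemannian_metric g"
    and \<psi>: "\<And>x. (\<psi> has_derivative D x) (at x)" "continuous_on UNIV (\<lambda>(x, u). D x u)"
    and \<phi>: "\<And>x. (\<phi> has_derivative D' x) (at x)" "continuous_on UNIV (\<lambda>(x, u). D' x u)"
    and inv: "\<And>x. \<phi> (\<psi> x) = x" "\<And>x. \<psi> (\<phi> x) = x"
    and c: "c > 0" and eq: "\<And>x u. metric_inner g' x u u = c * metric_inner g (\<psi> x) (D x u) (D x u)"
  shows "riem_dist g' x y = sqrt c * riem_dist g (\<psi> x) (\<psi> y)"
proof -
  have DD': "D (\<phi> x) (D' x u) = u" for x u
  proof -
    have "((\<psi> \<circ> \<phi>) has_derivative (D (\<phi> x) \<circ> D' x)) (at x)"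
      by (rule diff_chain_at[OF \<phi>(1) \<psi>(1)])
    moreover have "\<psi> \<circ> \<phi> = (\<lambda>x. x)" using inv by auto
    ultimately have "D (\<phi> x) \<circ> D' x = (\<lambda>x. x)"
      using has_derivative_unique[OF _ has_derivative_ident] by metis
    then show ?thesis by (metis comp_apply)
  qed
  have eq': "metric_inner g x u u = 1/c * metric_inner g' (\<phi> x) (D' x u) (D' x u)" for x u
    using c by (simp add: eq inv DD')
  have "lengths g' x y = (\<lambda>l. sqrt c * l) ` lengths g (\<psi> x) (\<psi> y)" (is "_ = ?R")
  proof (intro subset_antisym subsetI)
    fix l assume "l \<in> lengths g' x y"
    from lengths_image[OF \<psi> eq c this] show "l \<in> ?R"
      using c by (intro image_eqI[of _ _ "l / sqrt c"]) auto
  next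
    fix l assume "l \<in> ?R"
    then obtain l' where l': "l = sqrt c * l'" "l' \<in> lengths g (\<psi> x) (\<psi> y)" by blast
    from lengths_image[OF \<phi> eq' _ this(2)] show "l \<in> lengths g' x y"
      using c by (simp add: inv l'(1) real_sqrt_divide field_simps)
  qed
  moreover have "sqrt c * Inf (lengths g (\<psi> x) (\<psi> y)) = Inf ((\<lambda>l. sqrt c * l) ` lengths g (\<psi> x) (\<psi> y))"
    using c by (intro continuous_at_Inf_mono lengths_nonempty bdd_below_lengths g monoI)
       (auto intro!: continuous_intros)
  ultimately show ?thesis unfolding riem_dist_eq_Inf_lengths by simp
qed

lemma mcomplete_pullback:
  assumes "Metric_space UNIV d" "Metric_space UNIV d'" and c: "c > 0"
    and eq: "\<And>x y. d' x y = c * d (\<psi> x) (\<psi> y)" and inv: "\<And>x. \<psi> (\<phi> x) = x"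
    and compl: "Metric_space.mcomplete UNIV d"
  shows "Metric_space.mcomplete UNIV d'"
proof -
  interpret M: Metric_space UNIV d by fact
  interpret M': Metric_space UNIV d' by fact
  show ?thesis unfolding M'.mcomplete_def
  proof (intro allI impI)
    fix \<sigma> assume s: "M'.MCauchy \<sigma>"
    have "M.MCauchy (\<psi> \<circ> \<sigma>)" unfolding M.MCauchy_def
    proof (intro conjI allI impI)
      fix e :: real assume "e > 0"
      then have "c * e > 0" using c by simp
      then obtain N where "\<forall>n n'. N \<le> n \<longrightarrow> N \<le> n' \<longrightarrow> d' (\<sigma> n) (\<sigma> n') < c * e"
        using s unfolding M'.MCauchy_def by blast
      then show "\<exists>N. \<forall>n n'. N \<le> n \<longrightarrow> N \<le> n' \<longrightarrow> d ((\<psi> \<circ> \<sigma>) n) ((\<psi> \<circ> \<sigma>) n') < e"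
        using c by (auto simp: eq)
    qed simp
    then obtain x where x: "limitin M.mtopology (\<psi> \<circ> \<sigma>) x sequentially"
      using compl unfolding M.mcomplete_def by blast
    have "limitin M'.mtopology \<sigma> (\<phi> x) sequentially"
      unfolding M'.limitin_metric
    proof (intro conjI allI impI)
      fix e :: real assume "e > 0"
      then have "e / c > 0" using c by simp
      then have "\<forall>\<^sub>F n in sequentially. (\<psi> \<circ> \<sigma>) n \<in> UNIV \<and> d ((\<psi> \<circ> \<sigma>) n) x < e / c"
        using x unfolding M.limitin_metric by blast
      then show "\<forall>\<^sub>F n in sequentially. \<sigma> n \<in> UNIV \<and> d' (\<sigma> n) (\<phi> x) < e"
        by eventually_elim (use c in \<open>auto simp: eq inv field_simps\<close>)
    qed simp
    then show "\<exists>x. limitin M'.mtopology \<sigma> x sequentially" by blast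
  qed
qed

lemma complete_metric_pullback:
  assumes g: "riemannian_metric g" and g': "riemannian_metric g'" and "complete_metric g"
    and \<psi>: "\<And>x. (\<psi> has_derivative D x) (at x)" "continuous_on UNIV (\<lambda>(x, u). D x u)"
    and \<phi>: "\<And>x. (\<phi> has_derivative D' x) (at x)" "continuous_on UNIV (\<lambda>(x, u). D' x u)"
    and inv: "\<And>x. \<phi> (\<psi> x) = x" "\<And>x. \<psi> (\<phi> x) = x"
    and c: "c > 0" and eq: "\<And>x u. metric_inner g' x u u = c * metric_inner g (\<psi> x) (D x u) (D x u)"
  shows "complete_metric g'"
  using assms(3) unfolding complete_metric_def
  by (intro mcomplete_pullback[OF Metric_space_riem_dist[OF g] Metric_space_riem_dist[OF g'] _
        riem_dist_pullback[OF g \<psi> \<phi> inv c eq] inv(2)]) (use c in auto)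

lemma metric_inner_Euclidean: "metric_inner (\<lambda>x. mat 1) x u v = u \<bullet> v"
  by (simp add: metric_inner_def)

lemma riem_dist_Euclidean:
  assumes E: "riemannian_metric (\<lambda>x. mat 1 :: real ^ 'n ^ 'n)"
  shows "riem_dist (\<lambda>x. mat 1 :: real ^ 'n ^ 'n) x y = dist x y"
proof (rule antisym)
  have "speed (\<lambda>x. mat 1) (linepath x y) = (\<lambda>t. dist x y)"
    by (auto simp: speed_def metric_inner_Euclidean dist_norm norm_eq_sqrt_inner[symmetric] norm_minus_commute)
  with line_length_in_lengths[OF E, of x y] have "dist x y \<in> lengths (\<lambda>x. mat 1 :: real ^ 'n ^ 'n) x y"
    by simp
  then show "riem_dist (\<lambda>x. mat 1 :: real ^ 'n ^ 'n) x y \<le> dist x y"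
    unfolding riem_dist_eq_Inf_lengths by (intro cInf_lower bdd_below_lengths E)
  show "dist x y \<le> riem_dist (\<lambda>x. mat 1 :: real ^ 'n ^ 'n) x y"
    unfolding riem_dist_eq_Inf_lengths
  proof (intro cInf_greatest lengths_nonempty E)
    fix l assume "l \<in> lengths (\<lambda>x. mat 1 :: real ^ 'n ^ 'n) x y"
    then obtain \<gamma> where \<gamma>: "valid_path \<gamma>" "\<gamma> 0 = x" "\<gamma> 1 = y"
        "(speed (\<lambda>x. mat 1 :: real ^ 'n ^ 'n) \<gamma> has_integral l) {0..1}"
      by (auto simp: lengths_def pathstart_def pathfinish_def)
    show "dist x y \<le> l"
      using length_ge_displacement[OF E \<gamma>(1,4), of 1 1]
      by (simp add: \<gamma> metric_inner_Euclidean power2_norm_eq_inner)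
  qed
qed

lemma complete_metric_Euclidean:
  assumes E: "riemannian_metric (\<lambda>x. mat 1 :: real ^ 'n ^ 'n)"
  shows "complete_metric (\<lambda>x. mat 1 :: real ^ 'n ^ 'n)"
proof -
  have "riem_dist (\<lambda>x. mat 1 :: real ^ 'n ^ 'n) = dist"
    using riem_dist_Euclidean[OF E] by blast
  then show ?thesis
    unfolding complete_metric_def by (simp add: mcomplete_iff_complete complete_UNIV)
qed

section \<open>Partial derivatives of smooth functions\<close>

lemma iter_partial_Nil [simp]: "iter_partial [] f = f"
  by (simp add: iter_partial_def)

lemma iter_partial_Cons: "iter_partial (i # is) f = partial_deriv i (iter_partial is f)"
  by (simp add: iter_partial_def)

lemma iter_partial_snoc: "iter_partial (is @ [i]) f = iter_partial is (partial_deriv i f)"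
  by (simp add: iter_partial_def)

lemma smooth_function_partial_deriv: "smooth_function f \<Longrightarrow> smooth_function (partial_deriv i f)"
  unfolding smooth_function_def by (metis iter_partial_snoc)

lemma smooth_function_differentiable: "smooth_function f \<Longrightarrow> f differentiable (at x)"
  unfolding smooth_function_def using differentiable_on_def iter_partial_Nil by (metis UNIV_I)

lemma partial_deriv_eqI:
  "((\<lambda>t. f (x + t *\<^sub>R axis i 1)) has_field_derivative d) (at 0) \<Longrightarrow> partial_deriv i f x = d"
  unfolding partial_deriv_def by (rule DERIV_imp_deriv)

lemma has_derivative_partials:
  fixes f :: "real ^ 'n \<Rightarrow> real"
  assumes "f differentiable (at x)"
  shows "(f has_derivative (\<lambda>u. \<Sum>i\<in>UNIV. u $ i * partial_deriv i f x)) (at x)"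
proof -
  obtain D where D: "(f has_derivative D) (at x)"
    using assms unfolding differentiable_def by blast
  then interpret bounded_linear D by (rule has_derivative_bounded_linear)
  have pd: "partial_deriv i f x = D (axis i 1)" for i
  proof (rule partial_deriv_eqI)
    have "((\<lambda>t. x + t *\<^sub>R axis i 1) has_derivative (\<lambda>t. t *\<^sub>R axis i 1)) (at 0)"
      by (auto intro!: derivative_eq_intros)
    moreover have "(f has_derivative D) (at (x + 0 *\<^sub>R axis i 1))" using D by simp
    ultimately have "((\<lambda>t. f (x + t *\<^sub>R axis i 1)) has_derivative (\<lambda>t. D (t *\<^sub>R axis i 1))) (at 0)"
      by (rule has_derivative_compose)
    then show "((\<lambda>t. f (x + t *\<^sub>R axis i 1)) has_field_derivative D (axis i 1)) (at 0)"
      unfolding has_field_derivative_def scaleR by (simp add: mult_commute_abs)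
  qed
  have ex: "D u = (\<Sum>i\<in>UNIV. u $ i * D (axis i 1))" for u
  proof -
    have "u = (\<Sum>i\<in>UNIV. u $ i *\<^sub>R axis i 1)"
      by (metis (no_types) basis_expansion scalar_mult_eq_scaleR)
    then have "D u = D (\<Sum>i\<in>UNIV. u $ i *\<^sub>R axis i 1)" by (rule arg_cong)
    then show ?thesis by (simp add: sum scaleR)
  qed
  have "D = (\<lambda>u. \<Sum>i\<in>UNIV. u $ i * partial_deriv i f x)"
    unfolding pd by (rule ext) (rule ex)
  with D show ?thesis by simp
qed

lemma sum_axis_mult: "(\<Sum>i\<in>UNIV. (t *\<^sub>R axis j (1::real)) $ i * f i) = t * f j"
proof -
  have "(t *\<^sub>R axis j (1::real)) $ i * f i = (if i = j then t * f i else 0)" for i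
    by (simp add: axis_def)
  then show ?thesis by simp
qed

lemma partial_deriv_along:
  assumes "f differentiable (at (x + s *\<^sub>R axis i 1))"
  shows "((\<lambda>s. f (x + s *\<^sub>R axis i 1)) has_field_derivative partial_deriv i f (x + s *\<^sub>R axis i 1)) (at s)"
proof -
  have "((\<lambda>t. x + t *\<^sub>R axis i 1) has_derivative (\<lambda>t. t *\<^sub>R axis i 1)) (at s)"
    by (auto intro!: derivative_eq_intros)
  from has_derivative_compose[OF this has_derivative_partials[OF assms]]
  show ?thesis
    unfolding has_field_derivative_def sum_axis_mult by (simp add: mult_commute_abs)
qed

lemma has_partial_deriv:
  assumes "smooth_function f"
  shows "((\<lambda>t. f (x + t *\<^sub>R axis i 1)) has_field_derivative partial_deriv i f x) (at 0)"
  using partial_deriv_along[of f x 0 i] smooth_function_differentiable[OF assms] by simp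

text \<open>Two applications of the mean value theorem, first in direction \<open>i\<close> and then in direction \<open>j\<close>. The left
side is symmetric in \<open>i\<close> and \<open>j\<close>, which is what makes mixed partial derivatives commute.\<close>

lemma second_difference_mean_value:
  assumes f: "smooth_function f" and s: "s > 0"
  shows "\<exists>a\<in>{0<..<s}. \<exists>b\<in>{0<..<s}.
    f (x + s *\<^sub>R axis i 1 + s *\<^sub>R axis j 1) - f (x + s *\<^sub>R axis i 1) - (f (x + s *\<^sub>R axis j 1) - f x)
      = s * (s * partial_deriv j (partial_deriv i f) (x + a *\<^sub>R axis i 1 + b *\<^sub>R axis j 1))"
proof -
  let ?h = "\<lambda>t. f (x + s *\<^sub>R axis j 1 + t *\<^sub>R axis i 1) - f (x + t *\<^sub>R axis i 1)"
  note d = partial_deriv_along[OF smooth_function_differentiable]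
  have "(?h has_field_derivative (partial_deriv i f (x + s *\<^sub>R axis j 1 + t *\<^sub>R axis i 1)
      - partial_deriv i f (x + t *\<^sub>R axis i 1))) (at t)" for t
    by (intro DERIV_diff d f)
  from MVT2[OF s this] obtain a where a: "0 < a" "a < s" "?h s - ?h 0 =
    s * (partial_deriv i f (x + s *\<^sub>R axis j 1 + a *\<^sub>R axis i 1) - partial_deriv i f (x + a *\<^sub>R axis i 1))"
    by auto
  have "((\<lambda>t. partial_deriv i f (x + a *\<^sub>R axis i 1 + t *\<^sub>R axis j 1)) has_field_derivative
     partial_deriv j (partial_deriv i f) (x + a *\<^sub>R axis i 1 + t *\<^sub>R axis j 1)) (at t)" for t
    by (intro d smooth_function_partial_deriv f)
  from MVT2[OF s this] obtain b where b: "0 < b" "b < s"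
    "partial_deriv i f (x + a *\<^sub>R axis i 1 + s *\<^sub>R axis j 1) - partial_deriv i f (x + a *\<^sub>R axis i 1) =
    s * partial_deriv j (partial_deriv i f) (x + a *\<^sub>R axis i 1 + b *\<^sub>R axis j 1)"
    by auto
  show ?thesis
    using a b by (intro bexI[of _ a] bexI[of _ b]) (auto simp: algebra_simps)
qed

theorem mixed_partials_commute:
  assumes f: "smooth_function f"
  shows "partial_deriv i (partial_deriv j f) x = partial_deriv j (partial_deriv i f) x"
proof (rule ccontr)
  assume ne: "\<not> ?thesis"
  let ?p = "partial_deriv j (partial_deriv i f)" and ?q = "partial_deriv i (partial_deriv j f)"
  define e where "e = \<bar>?p x - ?q x\<bar> / 2"
  have e: "e > 0" using ne by (simp add: e_def)
  have c: "isCont ?p x" "isCont ?q x"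
    using smooth_function_continuous[OF smooth_function_partial_deriv[OF smooth_function_partial_deriv[OF f]], of UNIV]
    by (simp_all add: continuous_on_eq_continuous_at)
  obtain d where d: "d > 0" "\<And>y. dist y x < d \<Longrightarrow> dist (?p y) (?p x) < e"
    using c(1)[unfolded continuous_at_eps_delta, rule_format, OF e] by blast
  obtain d' where d': "d' > 0" "\<And>y. dist y x < d' \<Longrightarrow> dist (?q y) (?q x) < e"
    using c(2)[unfolded continuous_at_eps_delta, rule_format, OF e] by blast
  \<comment> \<open>With this step the points of the square spanned by \<open>s e\<^sub>i\<close> and \<open>s e\<^sub>j\<close> stay within \<open>d\<close> and \<open>d'\<close> of \<open>x\<close>.\<close>
  define s where "s = min d d' / 2"
  have s: "s > 0" using d d' by (simp add: s_def)
  obtain a b where ab: "a \<in> {0<..<s}" "b \<in> {0<..<s}"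
    "f (x + s *\<^sub>R axis i 1 + s *\<^sub>R axis j 1) - f (x + s *\<^sub>R axis i 1) - (f (x + s *\<^sub>R axis j 1) - f x)
      = s * (s * ?p (x + a *\<^sub>R axis i 1 + b *\<^sub>R axis j 1))"
    using second_difference_mean_value[OF f s] by blast
  obtain a' b' where ab': "a' \<in> {0<..<s}" "b' \<in> {0<..<s}"
    "f (x + s *\<^sub>R axis j 1 + s *\<^sub>R axis i 1) - f (x + s *\<^sub>R axis j 1) - (f (x + s *\<^sub>R axis i 1) - f x)
      = s * (s * ?q (x + a' *\<^sub>R axis j 1 + b' *\<^sub>R axis i 1))"
    using second_difference_mean_value[OF f s] by blast
  have "s * (s * ?p (x + a *\<^sub>R axis i 1 + b *\<^sub>R axis j 1)) = s * (s * ?q (x + a' *\<^sub>R axis j 1 + b' *\<^sub>R axis i 1))"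
    using ab(3) ab'(3) add.assoc[of x] add.commute[of "s *\<^sub>R axis i 1" "s *\<^sub>R axis j 1"] by smt
  then have eq: "?p (x + a *\<^sub>R axis i 1 + b *\<^sub>R axis j 1) = ?q (x + a' *\<^sub>R axis j 1 + b' *\<^sub>R axis i 1)"
    using s by simp
  have near: "dist (x + a *\<^sub>R axis k 1 + b *\<^sub>R axis l 1) x < min d d'"
    if "a \<in> {0<..<s}" "b \<in> {0<..<s}" for a b and k l :: 'a
  proof -
    have "norm (a *\<^sub>R axis k (1::real) + b *\<^sub>R axis l 1) \<le> \<bar>a\<bar> + \<bar>b\<bar>"
      using norm_triangle_ineq[of "a *\<^sub>R axis k (1::real)" "b *\<^sub>R axis l 1"] by simp
    also have "\<dots> < min d d'" using that by (auto simp: s_def)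
    finally show ?thesis by (simp add: dist_norm add.assoc)
  qed
  have "dist (?p (x + a *\<^sub>R axis i 1 + b *\<^sub>R axis j 1)) (?p x) < e"
       "dist (?q (x + a' *\<^sub>R axis j 1 + b' *\<^sub>R axis i 1)) (?q x) < e"
    using near[OF ab(1,2), of i j] near[OF ab'(1,2), of j i] by (intro d d'; simp)+
  then show False unfolding eq e_def dist_real_def by (simp add: abs_if split: if_splits)
qed

section \<open>Gaussian curvature in coordinates\<close>

text \<open>Twelve jet coordinates of a metric \<open>e dx\<^sup>2 + 2 f dx dy + g dy\<^sup>2\<close> enter the Gaussian curvature; this
polynomial is \<open>(e g - f\<^sup>2)\<^sup>2\<close> times the curvature (the formula of Brioschi). Clearing the denominator
turns the invariance under shears into a polynomial identity.\<close>

definition gauss_jet :: "real \<Rightarrow> real \<Rightarrow> real \<Rightarrow> real \<Rightarrow> real \<Rightarrow> real \<Rightarrow> real \<Rightarrow> real \<Rightarrow> real \<Rightarrow> real \<Rightarrow> real \<Rightarrow> real \<Rightarrow> real"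
  where "gauss_jet e f g e1 e2 f1 f2 g1 g2 f12 g11 e22 =
    (e * g - f\<^sup>2) * (f12 - g11 / 2 - e22 / 2)
      - (e1 * (g * (2 * f2 - g1) - f * g2) + (2 * f1 - e2) * (e * g2 - f * (2 * f2 - g1))) / 4
      + (e2 * (g * e2 - f * g1) + g1 * (e * g1 - f * e2)) / 4"

lemma gauss_jet_times_4:
  "4 * gauss_jet e f g e1 e2 f1 f2 g1 g2 f12 g11 e22 =
    4 * (e * g - f\<^sup>2) * (f12 - g11 / 2 - e22 / 2)
      - (e1 * (g * (2 * f2 - g1) - f * g2) + (2 * f1 - e2) * (e * g2 - f * (2 * f2 - g1)))
      + (e2 * (g * e2 - f * g1) + g1 * (e * g1 - f * e2))"
proof -
  have "4 * (p - a / 4 + b / 4) = 4 * p - a + b" for p a b :: real by simp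
  then show ?thesis unfolding gauss_jet_def by (simp only: mult.assoc)
qed

text \<open>How the jet of a metric changes under a shear whose first and second derivatives are \<open>H\<close> and \<open>K\<close>. The
determinant \<open>e g - f\<^sup>2\<close> is unchanged because shears preserve area, and so is the curvature.\<close>

lemma gauss_jet_shear:
  "gauss_jet (e + 2 * H * f + H\<^sup>2 * g) (f + H * g) g
      (e1 + H * e2 + 2 * K * f + 2 * H * (f1 + H * f2) + 2 * H * K * g + H\<^sup>2 * (g1 + H * g2))
      (e2 + 2 * H * f2 + H\<^sup>2 * g2)
      (f1 + H * f2 + K * g + H * (g1 + H * g2)) (f2 + H * g2)
      (g1 + H * g2) g2
      (f12 + H * f22 + K * g2 + H * (g12 + H * g22))
      (g11 + 2 * H * g12 + K * g2 + H\<^sup>2 * g22)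
      (e22 + 2 * H * f22 + H\<^sup>2 * g22)
    = gauss_jet e f g e1 e2 f1 f2 g1 g2 f12 g11 e22" (is "?l = ?r")
proof -
  have "4 * ?l = 4 * ?r" unfolding gauss_jet_times_4 by algebra
  then show ?thesis by simp
qed

definition gauss_num :: "(real ^ 2 \<Rightarrow> real) \<Rightarrow> (real ^ 2 \<Rightarrow> real) \<Rightarrow> (real ^ 2 \<Rightarrow> real) \<Rightarrow> real ^ 2 \<Rightarrow> real"
  where "gauss_num e f g x = gauss_jet (e x) (f x) (g x) (partial_deriv 1 e x) (partial_deriv 2 e x)
    (partial_deriv 1 f x) (partial_deriv 2 f x) (partial_deriv 1 g x) (partial_deriv 2 g x)
    (partial_deriv 1 (partial_deriv 2 f) x) (partial_deriv 1 (partial_deriv 1 g) x)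
    (partial_deriv 2 (partial_deriv 2 e) x)"

lemma matrix_inv_right_left:
  fixes A :: "'a::field ^ 'n ^ 'n"
  assumes "invertible A"
  shows "A ** matrix_inv A = mat 1" "matrix_inv A ** A = mat 1"
proof -
  have "A ** matrix_inv A = mat 1 \<and> matrix_inv A ** A = mat 1"
    using assms unfolding invertible_def matrix_inv_def by (rule someI_ex)
  then show "A ** matrix_inv A = mat 1" "matrix_inv A ** A = mat 1" by auto
qed

lemma matrix_inv_2:
  fixes A :: "real ^ 2 ^ 2"
  assumes "det A \<noteq> 0"
  shows "matrix_inv A $ 1 $ 1 = A $ 2 $ 2 / det A" "matrix_inv A $ 1 $ 2 = - A $ 1 $ 2 / det A"
    "matrix_inv A $ 2 $ 1 = - A $ 2 $ 1 / det A" "matrix_inv A $ 2 $ 2 = A $ 1 $ 1 / det A"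
proof -
  define B :: "real ^ 2 ^ 2" where "B = vector [vector [A $ 2 $ 2 / det A, - A $ 1 $ 2 / det A],
     vector [- A $ 2 $ 1 / det A, A $ 1 $ 1 / det A]]"
  have d: "A $ 1 $ 1 * A $ 2 $ 2 = det A + A $ 1 $ 2 * A $ 2 $ 1"
    by (simp add: det_2)
  have AB: "A ** B = mat 1"
    using assms d
    by (simp add: B_def vec_eq_iff forall_2 matrix_matrix_mult_def sum_2 mat_def field_simps)
  have inv: "invertible A" using assms by (simp add: invertible_det_nz)
  have "matrix_inv A = matrix_inv A ** (A ** B)" by (simp add: AB)
  also have "\<dots> = B" using inv by (simp add: matrix_mul_assoc matrix_inv_right_left)
  finally show "matrix_inv A $ 1 $ 1 = A $ 2 $ 2 / det A" "matrix_inv A $ 1 $ 2 = - A $ 1 $ 2 / det A"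
    "matrix_inv A $ 2 $ 1 = - A $ 2 $ 1 / det A" "matrix_inv A $ 2 $ 2 = A $ 1 $ 1 / det A"
    by (simp_all add: B_def)
qed

lemma metric_inner_2:
  fixes g :: "2 metric_field"
  shows "metric_inner g x u v = u $ 1 * (g x $ 1 $ 1 * v $ 1) + u $ 1 * (g x $ 1 $ 2 * v $ 2)
    + (u $ 2 * (g x $ 2 $ 1 * v $ 1) + u $ 2 * (g x $ 2 $ 2 * v $ 2))"
  by (simp add: metric_inner_eq_sum sum_2)

lemma riemannian_metric_2:
  fixes g :: "2 metric_field"
  assumes "riemannian_metric g"
  shows "g x $ 2 $ 1 = g x $ 1 $ 2" "g x $ 1 $ 1 > 0" "g x $ 2 $ 2 > 0"
    "g x $ 1 $ 1 * g x $ 2 $ 2 - (g x $ 1 $ 2)\<^sup>2 > 0"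
proof -
  note e = metric_inner_2
  show s: "g x $ 2 $ 1 = g x $ 1 $ 2"
    using riemannian_metric_symmetric[OF assms, of x "axis 1 1" "axis 2 1"]
    unfolding e by (simp add: axis_def)
  show p: "g x $ 1 $ 1 > 0" "g x $ 2 $ 2 > 0"
    using riemannian_metric_pos[OF assms, of "axis 1 1" x, simplified] riemannian_metric_pos[OF assms, of "axis 2 1" x, simplified]
    unfolding e by (simp_all add: axis_def)
  \<comment> \<open>This vector is \<open>g\<close>-orthogonal to the first basis vector; its squared length is \<open>g\<^sub>1\<^sub>1\<close> times the determinant.\<close>
  let ?v = "vector [- (g x $ 1 $ 2), g x $ 1 $ 1] :: real ^ 2"
  have "?v \<noteq> 0" using p by (simp add: vec_eq_iff forall_2)
  from riemannian_metric_pos[OF assms this, of x]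
  have "g x $ 1 $ 1 * (g x $ 1 $ 1 * g x $ 2 $ 2 - (g x $ 1 $ 2)\<^sup>2) > 0"
    unfolding e s by (simp add: power2_eq_square algebra_simps)
  then show "g x $ 1 $ 1 * g x $ 2 $ 2 - (g x $ 1 $ 2)\<^sup>2 > 0"
    using p zero_less_mult_pos by blast
qed

text \<open>Multiplying by \<open>g\<close> cancels the inverse matrix in the definition and leaves the Christoffel symbols of
the first kind. Differentiating this relation gives the derivatives of the Christoffel symbols without
differentiating the inverse matrix explicitly.\<close>

lemma christoffel_lowered:
  fixes g :: "2 metric_field"
  assumes "riemannian_metric g"
  shows "g y $ p $ 1 * christoffel g 1 i j y + g y $ p $ 2 * christoffel g 2 i j y =
    (partial_deriv i (\<lambda>y. g y $ j $ p) y + partial_deriv j (\<lambda>y. g y $ i $ p) y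
       - partial_deriv p (\<lambda>y. g y $ i $ j) y) / 2"
proof -
  have d: "det (g y) = g y $ 1 $ 1 * g y $ 2 $ 2 - (g y $ 1 $ 2)\<^sup>2" "det (g y) \<noteq> 0"
    using riemannian_metric_2[OF assms, of y] by (auto simp: det_2 power2_eq_square)
  have "(g y ** matrix_inv (g y)) $ p $ l = (if p = l then 1 else 0)" for l
    using d(2) by (simp add: invertible_det_nz matrix_inv_right_left mat_def)
  then have m: "g y $ p $ 1 * matrix_inv (g y) $ 1 $ l + g y $ p $ 2 * matrix_inv (g y) $ 2 $ l
      = (if p = l then 1 else 0)" for l
    by (simp add: matrix_matrix_mult_def sum_2)
  define b where "b l = partial_deriv i (\<lambda>y. g y $ j $ l) y + partial_deriv j (\<lambda>y. g y $ i $ l) y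
       - partial_deriv l (\<lambda>y. g y $ i $ j) y" for l
  have "g y $ p $ 1 * christoffel g 1 i j y + g y $ p $ 2 * christoffel g 2 i j y
     = 1/2 * ((g y $ p $ 1 * matrix_inv (g y) $ 1 $ 1 + g y $ p $ 2 * matrix_inv (g y) $ 2 $ 1) * b 1
        + (g y $ p $ 1 * matrix_inv (g y) $ 1 $ 2 + g y $ p $ 2 * matrix_inv (g y) $ 2 $ 2) * b 2)"
    unfolding christoffel_def sum_2 b_def[symmetric] by (simp add: algebra_simps)
  also have "\<dots> = b p / 2"
    unfolding m using exhaust_2[of p] by auto
  finally show ?thesis unfolding b_def .
qed

lemma christoffel_has_partial_deriv:
  fixes g :: "2 metric_field"
  assumes g: "riemannian_metric g"
  shows "((\<lambda>t. christoffel g k i j (x + t *\<^sub>R axis a 1)) has_field_derivative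
     partial_deriv a (christoffel g k i j) x) (at 0)"
proof -
  have sm: "smooth_function (\<lambda>x. g x $ i $ j)" for i j
    using g unfolding riemannian_metric_def by blast
  have inv: "\<exists>D. ((\<lambda>t. matrix_inv (g (x + t *\<^sub>R axis a 1)) $ k $ l) has_field_derivative D) (at 0)" for k l
  proof -
    have d: "det (g y) = g y $ 1 $ 1 * g y $ 2 $ 2 - g y $ 1 $ 2 * g y $ 2 $ 1" "det (g y) \<noteq> 0" for y
      using riemannian_metric_2[OF g, of y] by (auto simp: det_2 power2_eq_square)
    have dd: "((\<lambda>t. det (g (x + t *\<^sub>R axis a 1))) has_field_derivative
       (partial_deriv a (\<lambda>x. g x $ 1 $ 1) x * g x $ 2 $ 2 + partial_deriv a (\<lambda>x. g x $ 2 $ 2) x * g x $ 1 $ 1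
        - (partial_deriv a (\<lambda>x. g x $ 1 $ 2) x * g x $ 2 $ 1 + partial_deriv a (\<lambda>x. g x $ 2 $ 1) x * g x $ 1 $ 2))) (at 0)"
      unfolding d(1) by (auto intro!: derivative_eq_intros has_partial_deriv[OF sm])
    have "\<exists>D. ((\<lambda>t. g (x + t *\<^sub>R axis a 1) $ p $ q / det (g (x + t *\<^sub>R axis a 1))) has_field_derivative D) (at 0)" for p q
      by (rule exI, rule DERIV_divide[OF has_partial_deriv[OF sm] dd]) (simp add: d(2))
    moreover have "\<exists>D. ((\<lambda>t. - g (x + t *\<^sub>R axis a 1) $ p $ q / det (g (x + t *\<^sub>R axis a 1))) has_field_derivative D) (at 0)" for p q
      by (rule exI, rule DERIV_divide[OF DERIV_minus[OF has_partial_deriv[OF sm]] dd]) (simp add: d(2))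
    ultimately show ?thesis
      using exhaust_2[of k] exhaust_2[of l] by (auto simp: matrix_inv_2[OF d(2)])
  qed
  obtain I where I: "\<And>k l. ((\<lambda>t. matrix_inv (g (x + t *\<^sub>R axis a 1)) $ k $ l) has_field_derivative I k l) (at 0)"
    using inv by metis
  note sp = has_partial_deriv[OF smooth_function_partial_deriv[OF sm]]
  have "\<exists>D. ((\<lambda>t. christoffel g k i j (x + t *\<^sub>R axis a 1)) has_field_derivative D) (at 0)"
    unfolding christoffel_def sum_2
    by (rule exI, (rule DERIV_cmult DERIV_add DERIV_mult DERIV_diff I sp)+)
  then show ?thesis
    unfolding partial_deriv_def by (metis DERIV_imp_deriv)
qed

lemma christoffel_lowered_partial_deriv:
  fixes g :: "2 metric_field"
  assumes g: "riemannian_metric g"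
  shows "g x $ p $ 1 * partial_deriv a (christoffel g 1 i j) x + g x $ p $ 2 * partial_deriv a (christoffel g 2 i j) x =
    (partial_deriv a (partial_deriv i (\<lambda>y. g y $ j $ p)) x + partial_deriv a (partial_deriv j (\<lambda>y. g y $ i $ p)) x
       - partial_deriv a (partial_deriv p (\<lambda>y. g y $ i $ j)) x) / 2
    - (partial_deriv a (\<lambda>y. g y $ p $ 1) x * christoffel g 1 i j x + partial_deriv a (\<lambda>y. g y $ p $ 2) x * christoffel g 2 i j x)"
    (is "?l = ?r1 - ?r2")
proof -
  have sm: "smooth_function (\<lambda>x. g x $ i $ j)" for i j
    using g unfolding riemannian_metric_def by blast
  note sp = has_partial_deriv[OF smooth_function_partial_deriv[OF sm]]
  let ?x = "\<lambda>t. x + t *\<^sub>R axis a 1"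
  have "((\<lambda>t. g (?x t) $ p $ 1 * christoffel g 1 i j (?x t) + g (?x t) $ p $ 2 * christoffel g 2 i j (?x t))
     has_field_derivative ?l + ?r2) (at 0)"
    by (rule derivative_eq_intros has_partial_deriv[OF sm] christoffel_has_partial_deriv[OF g] refl)+ simp
  moreover have "((\<lambda>t. g (?x t) $ p $ 1 * christoffel g 1 i j (?x t) + g (?x t) $ p $ 2 * christoffel g 2 i j (?x t))
     has_field_derivative ?r1) (at 0)"
    unfolding christoffel_lowered[OF g]
    by (intro DERIV_cdivide DERIV_add DERIV_diff sp)
  ultimately have "?l + ?r2 = ?r1" by (rule DERIV_unique)
  then show ?thesis by linarith
qed

text \<open>The lowered coefficients \<open>R\<^bsub>p k 1 2\<^esub>\<close> are skew in \<open>p\<close> and \<open>k\<close> because the connection is metric and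
second partial derivatives commute. In dimension two a single one of them is left.\<close>

lemma curvature_coeff_lowered:
  fixes g :: "2 metric_field" and x :: "real ^ 2"
  assumes g: "riemannian_metric g"
  defines "low \<equiv> \<lambda>p k. g x $ p $ 1 * curvature_coeff g 1 1 2 k x + g x $ p $ 2 * curvature_coeff g 2 1 2 k x"
  defines "D \<equiv> g x $ 1 $ 1 * g x $ 2 $ 2 - (g x $ 1 $ 2)\<^sup>2"
  shows "low 1 1 = 0" "low 2 2 = 0" "low 2 1 = - low 1 2"
    "D * low 1 2 = gauss_num (\<lambda>y. g y $ 1 $ 1) (\<lambda>y. g y $ 1 $ 2) (\<lambda>y. g y $ 2 $ 2) x"
proof -
  have sm: "smooth_function (\<lambda>x. g x $ i $ j)" for i j
    using g unfolding riemannian_metric_def by blast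
  have sy: "g y $ 2 $ 1 = g y $ 1 $ 2" for y
    by (rule riemannian_metric_2[OF g])
  have sy': "g y $ i $ j = g y $ j $ i" for y i j
    using exhaust_2[of i] exhaust_2[of j] sy by metis
  define c where "c k i j = christoffel g k i j x" for k i j
  define dc where "dc a k i j = partial_deriv a (christoffel g k i j) x" for a k i j
  define d where "d a i j = partial_deriv a (\<lambda>y. g y $ i $ j) x" for a i j
  define d2 where "d2 a b i j = partial_deriv a (partial_deriv b (\<lambda>y. g y $ i $ j)) x" for a b i j
  \<comment> \<open>\<open>b i j p\<close> are the Christoffel symbols of the first kind, \<open>db a i j p\<close> their derivatives.\<close>
  define b where "b i j p = (d i j p + d j i p - d p i j) / 2" for i j p
  define db where "db a i j p = (d2 a i j p + d2 a j i p - d2 a p i j) / 2" for a i j p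
  have csym: "c k i j = c k j i" for k i j
  proof -
    have "(\<lambda>y. g y $ i $ j) = (\<lambda>y. g y $ j $ i)" for i j using sy' by blast
    then show ?thesis unfolding c_def christoffel_def by (metis (no_types, lifting) add.commute)
  qed
  have dsym: "d a i j = d a j i" for a i j
    unfolding d_def by (metis (no_types, lifting) sy')
  have d2sym: "d2 a b i j = d2 a b j i" for a b i j
    unfolding d2_def by (metis (no_types, lifting) sy')
  have d2comm: "d2 a b i j = d2 b a i j" for a b i j
    unfolding d2_def by (rule mixed_partials_commute[OF sm])
  have L0: "g x $ p $ 1 * c 1 i j + g x $ p $ 2 * c 2 i j = b i j p" for p i j
    unfolding c_def b_def d_def by (rule christoffel_lowered[OF g])
  have L1: "g x $ p $ 1 * dc a 1 i j + g x $ p $ 2 * dc a 2 i j =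
     db a i j p - (d a p 1 * c 1 i j + d a p 2 * c 2 i j)" for p a i j
    unfolding c_def dc_def db_def d2_def d_def by (rule christoffel_lowered_partial_deriv[OF g])
  have dg: "d a p l = b a p l + b a l p" for a p l
    unfolding b_def using dsym by (simp add: field_simps)
  have low: "low p k = db 1 2 k p - db 2 1 k p - (b 1 p 1 * c 1 2 k + b 1 p 2 * c 2 2 k)
      + (b 2 p 1 * c 1 1 k + b 2 p 2 * c 2 1 k)" for p k
  proof -
    have "low p k = (g x $ p $ 1 * dc 1 1 2 k + g x $ p $ 2 * dc 1 2 2 k)
        - (g x $ p $ 1 * dc 2 1 1 k + g x $ p $ 2 * dc 2 2 1 k)
        + (c 1 2 k * (g x $ p $ 1 * c 1 1 1 + g x $ p $ 2 * c 2 1 1)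
          + c 2 2 k * (g x $ p $ 1 * c 1 1 2 + g x $ p $ 2 * c 2 1 2))
        - (c 1 1 k * (g x $ p $ 1 * c 1 2 1 + g x $ p $ 2 * c 2 2 1)
          + c 2 1 k * (g x $ p $ 1 * c 1 2 2 + g x $ p $ 2 * c 2 2 2))"
      unfolding low_def curvature_coeff_def sum_2 c_def dc_def by (simp add: algebra_simps)
    then show ?thesis
      unfolding L0 L1 dg by (simp add: algebra_simps)
  qed
  have c21: "c k 2 1 = c k 1 2" for k by (rule csym)
  have b21: "b 2 1 p = b 1 2 p" for p unfolding b_def using dsym[of p 2 1] by simp
  have d21: "d a 2 1 = d a 1 2" for a by (rule dsym)
  have d2_21: "d2 a b 2 1 = d2 a b 1 2" "d2 2 1 i j = d2 1 2 i j" for a b i j by (rule d2sym d2comm)+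
  show "low 1 1 = 0" "low 2 2 = 0" "low 2 1 = - low 1 2"
    unfolding low L0[symmetric] db_def c21 sy d2_21 by (simp_all add: field_simps)
  have D1: "D * c 1 i j = g x $ 2 $ 2 * b i j 1 - g x $ 1 $ 2 * b i j 2" for i j
    unfolding L0[symmetric] D_def sy by (simp add: algebra_simps power2_eq_square)
  have D2: "D * c 2 i j = g x $ 1 $ 1 * b i j 2 - g x $ 1 $ 2 * b i j 1" for i j
    unfolding L0[symmetric] D_def sy by (simp add: algebra_simps power2_eq_square)
  have "D * low 1 2 = D * (db 1 2 2 1 - db 2 1 2 1) - (b 1 1 1 * (D * c 1 2 2) + b 1 1 2 * (D * c 2 2 2))
      + (b 1 2 1 * (D * c 1 1 2) + b 1 2 2 * (D * c 2 1 2))"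
    unfolding low b21 by (simp add: algebra_simps)
  also have "\<dots> = gauss_num (\<lambda>y. g y $ 1 $ 1) (\<lambda>y. g y $ 1 $ 2) (\<lambda>y. g y $ 2 $ 2) x"
    unfolding D1 D2 gauss_num_def gauss_jet_def d_def[symmetric] d2_def[symmetric] D_def[symmetric]
      b_def db_def d21 d2_21 by (simp add: field_simps)
  finally show "D * low 1 2 = \<dots>" .
qed

text \<open>Numerator and denominator of the sectional curvature of the plane spanned by \<open>u\<close> and \<open>v\<close> both carry the
factor \<open>(u\<^sub>1 v\<^sub>2 - u\<^sub>2 v\<^sub>1)\<^sup>2\<close>, so its sign is that of the lowered curvature coefficient. Dependent
\<open>u\<close>, \<open>v\<close> give \<open>0 / 0 = 0\<close>.\<close>

lemma nonneg_curved_iff_gauss_num: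
  fixes g :: "2 metric_field"
  assumes g: "riemannian_metric g"
  shows "nonneg_curved g \<longleftrightarrow> (\<forall>x. gauss_num (\<lambda>y. g y $ 1 $ 1) (\<lambda>y. g y $ 1 $ 2) (\<lambda>y. g y $ 2 $ 2) x \<ge> 0)"
proof -
  let ?n = "gauss_num (\<lambda>y. g y $ 1 $ 1) (\<lambda>y. g y $ 1 $ 2) (\<lambda>y. g y $ 2 $ 2)"
  define D where "D x = g x $ 1 $ 1 * g x $ 2 $ 2 - (g x $ 1 $ 2)\<^sup>2" for x
  have D: "D x > 0" for x unfolding D_def by (rule riemannian_metric_2[OF g])
  define w where "w u v = u $ 1 * v $ 2 - u $ 2 * v $ 1" for u v :: "real ^ 2"
  have key: "sectional_curvature g x u v = ?n x / D x * (w u v)\<^sup>2 / (D x * (w u v)\<^sup>2)" for x u v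
  proof -
    have sy: "g x $ 2 $ 1 = g x $ 1 $ 2" by (rule riemannian_metric_2[OF g])
    let ?r = "\<lambda>l k. curvature_coeff g l 1 2 k x"
    \<comment> \<open>The lowered coefficients: \<open>low p k\<close> is \<open>R\<^bsub>p k 1 2\<^esub>\<close>.\<close>
    define low where "low p k = g x $ p $ 1 * ?r 1 k + g x $ p $ 2 * ?r 2 k" for p k
    note low = curvature_coeff_lowered[OF g, of x, folded low_def D_def]
    have r: "curvature_coeff g l i i k x = 0" "curvature_coeff g l 2 1 k x = - ?r l k" for l i k
      by (simp_all add: curvature_coeff_def sum_2 algebra_simps)
    have op: "curvature_op g x u v v $ l = w u v * (?r l 1 * v $ 1 + ?r l 2 * v $ 2)" for l
      unfolding curvature_op_def w_def by (simp add: sum_2 r algebra_simps)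
    have "metric_inner g x (curvature_op g x u v v) u = w u v *
       (u $ 1 * (low 1 1 * v $ 1 + low 1 2 * v $ 2) + u $ 2 * (low 2 1 * v $ 1 + low 2 2 * v $ 2))"
      unfolding metric_inner_eq_sum sum_2 op low_def sy by (simp add: algebra_simps)
    also have "\<dots> = low 1 2 * (w u v)\<^sup>2"
      unfolding low(1-3) by (simp add: w_def power2_eq_square algebra_simps)
    also have "low 1 2 = ?n x / D x"
      using low(4) D[of x] by (simp add: field_simps)
    finally have num: "metric_inner g x (curvature_op g x u v v) u = ?n x / D x * (w u v)\<^sup>2" .
    have den: "metric_inner g x u u * metric_inner g x v v - (metric_inner g x u v)\<^sup>2 = D x * (w u v)\<^sup>2"
      unfolding metric_inner_eq_sum sum_2 D_def w_def sy by (simp add: power2_eq_square algebra_simps)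
    show ?thesis unfolding sectional_curvature_def num den by (rule refl)
  qed
  show ?thesis
  proof
    assume "nonneg_curved g"
    moreover have "axis 1 1 \<noteq> (axis 2 1 :: real ^ 2)" by (simp add: axis_eq_axis)
    moreover have "independent {axis 1 1, axis 2 1 :: real ^ 2}"
      by (rule independent_mono[OF independent_Basis]) (auto simp: Basis_vec_def)
    ultimately have "sectional_curvature g x (axis 1 1) (axis 2 1) \<ge> 0" for x
      unfolding nonneg_curved_def by blast
    moreover have "w (axis 1 1) (axis 2 1) = 1" by (simp add: w_def axis_def)
    ultimately have "?n x / D x / D x \<ge> 0" for x unfolding key by simp
    then have nn: "?n x / D x / D x * (D x * D x) \<ge> 0" for x
      by (intro mult_nonneg_nonneg zero_le_square)
    have "?n x / D x / D x * (D x * D x) = ?n x" for x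
      using D[of x] by simp
    then show "\<forall>x. ?n x \<ge> 0" using nn by metis
  next
    assume "\<forall>x. ?n x \<ge> 0"
    then show "nonneg_curved g"
      unfolding nonneg_curved_def key using D by (simp add: less_imp_le)
  qed
qed

section \<open>Curvature under zooms and shears\<close>

lemma partial_deriv_zoom:
  fixes f :: "real ^ 'n \<Rightarrow> real"
  assumes "smooth_function f"
  shows "partial_deriv i (\<lambda>x. c * f (z + t *\<^sub>R (x - z))) = (\<lambda>x. c * t * partial_deriv i f (z + t *\<^sub>R (x - z)))"
proof
  fix x
  let ?y = "z + t *\<^sub>R (x - z)"
  have "((\<lambda>s. t * s) has_field_derivative t) (at 0)" by (auto intro!: derivative_eq_intros)
  moreover have "((\<lambda>s. f (?y + s *\<^sub>R axis i 1)) has_field_derivative partial_deriv i f ?y) (at (t * 0))"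
    using has_partial_deriv[OF assms, of ?y i] by simp
  ultimately have "((\<lambda>s. f (?y + (t * s) *\<^sub>R axis i 1)) has_field_derivative partial_deriv i f ?y * t) (at 0)"
    by (rule DERIV_chain2[where f = "\<lambda>s. f (?y + s *\<^sub>R axis i 1)" and g = "\<lambda>s. t * s", rotated])
  then have "((\<lambda>s. c * f (?y + (t * s) *\<^sub>R axis i 1)) has_field_derivative c * (partial_deriv i f ?y * t)) (at 0)"
    by (rule DERIV_cmult)
  then show "partial_deriv i (\<lambda>x. c * f (z + t *\<^sub>R (x - z))) x = c * t * partial_deriv i f ?y"
    by (intro partial_deriv_eqI) (simp add: algebra_simps)
qed

lemma gauss_num_zoom:
  assumes "smooth_function e" "smooth_function f" "smooth_function g"
  shows "gauss_num (\<lambda>x. c * e (z + t *\<^sub>R (x - z))) (\<lambda>x. c * f (z + t *\<^sub>R (x - z))) (\<lambda>x. c * g (z + t *\<^sub>R (x - z))) x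
    = c ^ 3 * t\<^sup>2 * gauss_num e f g (z + t *\<^sub>R (x - z))"
  unfolding gauss_num_def gauss_jet_def
  by (simp add: partial_deriv_zoom assms smooth_function_partial_deriv)
     (simp add: power2_eq_square power3_eq_cube algebra_simps diff_divide_distrib add_divide_distrib)

definition shear :: "(real \<Rightarrow> real) \<Rightarrow> real ^ 2 \<Rightarrow> real ^ 2"
  where "shear h x = x + h (x $ 1) *\<^sub>R axis 2 1"

lemma shear_component [simp]: "shear h x $ 1 = x $ 1" "shear h x $ 2 = x $ 2 + h (x $ 1)"
  by (simp_all add: shear_def axis_def)

lemma has_derivative_shear:
  assumes "(h has_field_derivative h') (at (x $ 1))"
  shows "(shear h has_derivative (\<lambda>u. u + (h' * u $ 1) *\<^sub>R axis 2 1)) (at x)"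
proof -
  have "((\<lambda>x. h (x $ 1)) has_derivative (\<lambda>u. h' * u $ 1)) (at x)"
    using has_derivative_compose[of "\<lambda>x. x $ 1" "\<lambda>u. u $ 1" x UNIV h "\<lambda>u. h' * u"] assms
    by (simp add: has_field_derivative_def bounded_linear_imp_has_derivative bounded_linear_vec_nth)
  then show ?thesis
    unfolding shear_def[abs_def] by (auto intro!: derivative_eq_intros)
qed

lemma partial_deriv_comp_shear:
  assumes f: "smooth_function f" and h: "\<And>s. (h has_field_derivative h' s) (at s)"
  shows "((\<lambda>t. f (shear h (x + t *\<^sub>R axis 1 1))) has_field_derivative
      partial_deriv 1 f (shear h x) + h' (x $ 1) * partial_deriv 2 f (shear h x)) (at 0)"
    and "((\<lambda>t. f (shear h (x + t *\<^sub>R axis 2 1))) has_field_derivative partial_deriv 2 f (shear h x)) (at 0)"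
proof -
  have l: "((\<lambda>t. x + t *\<^sub>R axis i 1) has_derivative (\<lambda>t. t *\<^sub>R axis i 1)) (at 0)" for i :: 2
    by (auto intro!: derivative_eq_intros)
  have s: "(shear h has_derivative (\<lambda>u. u + (h' (x $ 1) * u $ 1) *\<^sub>R axis 2 1)) (at (x + 0 *\<^sub>R axis i 1))" for i :: 2
    using has_derivative_shear[OF h] by simp
  have f': "(f has_derivative (\<lambda>u. u $ 1 * partial_deriv 1 f (shear h x) + u $ 2 * partial_deriv 2 f (shear h x)))
     (at (shear h (x + 0 *\<^sub>R axis i 1)))" for i :: 2
    using has_derivative_partials[OF smooth_function_differentiable[OF f, of "shear h x"]] by (simp add: sum_2)
  show "((\<lambda>t. f (shear h (x + t *\<^sub>R axis 1 1))) has_field_derivative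
      partial_deriv 1 f (shear h x) + h' (x $ 1) * partial_deriv 2 f (shear h x)) (at 0)"
    unfolding has_field_derivative_def
    by (rule has_derivative_eq_rhs[OF has_derivative_compose[OF has_derivative_compose[OF l s] f']])
       (auto simp: axis_def algebra_simps)
  show "((\<lambda>t. f (shear h (x + t *\<^sub>R axis 2 1))) has_field_derivative partial_deriv 2 f (shear h x)) (at 0)"
    unfolding has_field_derivative_def
    by (rule has_derivative_eq_rhs[OF has_derivative_compose[OF has_derivative_compose[OF l s] f']])
       (auto simp: axis_def algebra_simps)
qed

lemma gauss_num_shear:
  assumes e: "smooth_function e" and f: "smooth_function f" and g: "smooth_function g"
    and h: "\<And>s. (h has_field_derivative h1 s) (at s)" "\<And>s. (h1 has_field_derivative h2 s) (at s)"
  shows "gauss_num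
     (\<lambda>x. e (shear h x) + 2 * h1 (x $ 1) * f (shear h x) + (h1 (x $ 1))\<^sup>2 * g (shear h x))
     (\<lambda>x. f (shear h x) + h1 (x $ 1) * g (shear h x)) (\<lambda>x. g (shear h x)) x
    = gauss_num e f g (shear h x)" (is "gauss_num ?E ?F ?G x = _")
proof -
  note sm = smooth_function_partial_deriv
  note d = partial_deriv_comp_shear[OF _ h(1)]
  have H1: "((\<lambda>t. h1 ((x + t *\<^sub>R axis 1 1) $ 1)) has_field_derivative h2 (x $ 1)) (at 0)" for x :: "real ^ 2"
  proof -
    have "((\<lambda>t. x $ 1 + t) has_field_derivative 1) (at 0)" by (auto intro!: derivative_eq_intros)
    from DERIV_chain2[of h1 "h2 (x $ 1)" "\<lambda>t. x $ 1 + t", OF _ this] h(2)[of "x $ 1"] show ?thesis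
      by (simp add: axis_def)
  qed
  have H2: "((\<lambda>t. h1 ((x + t *\<^sub>R axis 2 1) $ 1)) has_field_derivative 0) (at 0)" for x :: "real ^ 2"
    by (simp add: axis_def)
  let ?s = "shear h"
  have G1: "partial_deriv 1 ?G = (\<lambda>x. partial_deriv 1 g (?s x) + h1 (x $ 1) * partial_deriv 2 g (?s x))"
    by (rule ext, rule partial_deriv_eqI, rule d(1)[OF g])
  have G2: "partial_deriv 2 ?G = (\<lambda>x. partial_deriv 2 g (?s x))"
    by (rule ext, rule partial_deriv_eqI, rule d(2)[OF g])
  have G11: "partial_deriv 1 (partial_deriv 1 ?G) x = partial_deriv 1 (partial_deriv 1 g) (?s x)
     + 2 * h1 (x $ 1) * partial_deriv 1 (partial_deriv 2 g) (?s x) + h2 (x $ 1) * partial_deriv 2 g (?s x)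
     + (h1 (x $ 1))\<^sup>2 * partial_deriv 2 (partial_deriv 2 g) (?s x)"
    unfolding G1
    by (rule partial_deriv_eqI, (rule derivative_eq_intros d(1)[OF sm[OF g]] H1 refl)+)
       (simp add: mixed_partials_commute[OF g, of 2 1] power2_eq_square algebra_simps)
  have F1: "partial_deriv 1 ?F = (\<lambda>x. partial_deriv 1 f (?s x) + h1 (x $ 1) * partial_deriv 2 f (?s x)
     + h2 (x $ 1) * g (?s x) + h1 (x $ 1) * (partial_deriv 1 g (?s x) + h1 (x $ 1) * partial_deriv 2 g (?s x)))"
    by (rule ext, rule partial_deriv_eqI, (rule derivative_eq_intros d(1)[OF f] d(1)[OF g] H1 refl)+)
       (simp add: power2_eq_square algebra_simps)
  have F2: "partial_deriv 2 ?F = (\<lambda>x. partial_deriv 2 f (?s x) + h1 (x $ 1) * partial_deriv 2 g (?s x))"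
    by (rule ext, rule partial_deriv_eqI, (rule derivative_eq_intros d(2)[OF f] d(2)[OF g] H2 refl)+) simp
  have F12: "partial_deriv 1 (partial_deriv 2 ?F) x = partial_deriv 1 (partial_deriv 2 f) (?s x)
     + h1 (x $ 1) * partial_deriv 2 (partial_deriv 2 f) (?s x) + h2 (x $ 1) * partial_deriv 2 g (?s x)
     + h1 (x $ 1) * (partial_deriv 1 (partial_deriv 2 g) (?s x) + h1 (x $ 1) * partial_deriv 2 (partial_deriv 2 g) (?s x))"
    unfolding F2
    by (rule partial_deriv_eqI, (rule derivative_eq_intros d(1)[OF sm[OF f]] d(1)[OF sm[OF g]] H1 refl)+)
       (simp add: power2_eq_square algebra_simps)
  have E1: "partial_deriv 1 ?E = (\<lambda>x. partial_deriv 1 e (?s x) + h1 (x $ 1) * partial_deriv 2 e (?s x)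
     + 2 * h2 (x $ 1) * f (?s x) + 2 * h1 (x $ 1) * (partial_deriv 1 f (?s x) + h1 (x $ 1) * partial_deriv 2 f (?s x))
     + 2 * h1 (x $ 1) * h2 (x $ 1) * g (?s x)
     + (h1 (x $ 1))\<^sup>2 * (partial_deriv 1 g (?s x) + h1 (x $ 1) * partial_deriv 2 g (?s x)))"
    by (rule ext, rule partial_deriv_eqI, (rule derivative_eq_intros d(1)[OF e] d(1)[OF f] d(1)[OF g] H1 refl)+)
       (simp add: power2_eq_square algebra_simps)
  have E2: "partial_deriv 2 ?E = (\<lambda>x. partial_deriv 2 e (?s x) + 2 * h1 (x $ 1) * partial_deriv 2 f (?s x)
     + (h1 (x $ 1))\<^sup>2 * partial_deriv 2 g (?s x))"
    by (rule ext, rule partial_deriv_eqI, (rule derivative_eq_intros d(2)[OF e] d(2)[OF f] d(2)[OF g] H2 refl)+) simp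
  have E22: "partial_deriv 2 (partial_deriv 2 ?E) x = partial_deriv 2 (partial_deriv 2 e) (?s x)
     + 2 * h1 (x $ 1) * partial_deriv 2 (partial_deriv 2 f) (?s x)
     + (h1 (x $ 1))\<^sup>2 * partial_deriv 2 (partial_deriv 2 g) (?s x)"
    unfolding E2
    by (rule partial_deriv_eqI, (rule derivative_eq_intros d(2)[OF sm[OF e]] d(2)[OF sm[OF f]] d(2)[OF sm[OF g]] H2 refl)+) simp
  show ?thesis
    unfolding gauss_num_def G11 F12 E22
    unfolding G1 G2 F1 F2 E1 E2 by (rule gauss_jet_shear)
qed

section \<open>Smooth families of functions\<close>

text \<open>A parametrized family all of whose partial derivatives in \<open>x\<close> depend continuously on parameter and
point together: the parametrized objects that move continuously in every \<open>C\<^sup>k\<close> topology. A family with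
a constant parameter is a smooth function, so closure properties proved here serve both notions.\<close>

definition smooth_family :: "('p::topological_space \<Rightarrow> real ^ 'n \<Rightarrow> real) \<Rightarrow> bool"
  where "smooth_family F \<longleftrightarrow>
    (\<forall>is. continuous_on UNIV (\<lambda>(p, x). iter_partial is (F p) x) \<and>
      (\<forall>p x. iter_partial is (F p) differentiable (at x)))"

lemma smooth_family_smooth_function: "smooth_family F \<Longrightarrow> smooth_function (F p)"
  unfolding smooth_family_def smooth_function_def differentiable_on_def by simp

lemma smooth_family_partial_deriv: "smooth_family F \<Longrightarrow> smooth_family (\<lambda>p. partial_deriv i (F p))"
  unfolding smooth_family_def iter_partial_snoc[symmetric] by blast

lemma smooth_family_continuous: "smooth_family F \<Longrightarrow> continuous_on UNIV (\<lambda>(p, x). F p x)"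
  unfolding smooth_family_def using iter_partial_Nil by (auto dest!: spec[of _ "[]"])

lemma smooth_family_differentiable: "smooth_family F \<Longrightarrow> F p differentiable (at x)"
  unfolding smooth_family_def using iter_partial_Nil by (auto dest!: spec[of _ "[]"])

text \<open>Smooth families form the largest class of continuous families of differentiable functions that is
closed under partial derivatives.\<close>

lemma smooth_family_coinduct:
  assumes "F \<in> S"
    and cont: "\<And>F. F \<in> S \<Longrightarrow> continuous_on UNIV (\<lambda>(p, x). F p x)"
    and diff: "\<And>F p x. F \<in> S \<Longrightarrow> F p differentiable (at x)"
    and part: "\<And>F i. F \<in> S \<Longrightarrow> (\<lambda>p. partial_deriv i (F p)) \<in> S"
  shows "smooth_family F"
proof -
  have "(\<lambda>p. iter_partial is (F p)) \<in> S" for "is"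
  proof (induction "is")
    case Nil
    then show ?case using assms(1) by simp
  next
    case (Cons i "is")
    from part[OF this] show ?case by (simp add: iter_partial_Cons)
  qed
  then show ?thesis
    unfolding smooth_family_def using cont diff by fastforce
qed

lemma partial_deriv_const [simp]: "partial_deriv i (\<lambda>x. c) = (\<lambda>x. 0)"
  by (simp add: partial_deriv_def fun_eq_iff)

lemma partial_deriv_add:
  assumes "f differentiable (at x)" "g differentiable (at x)"
  shows "partial_deriv i (\<lambda>x. f x + g x) x = partial_deriv i f x + partial_deriv i g x"
  using partial_deriv_along[of f x 0 i] partial_deriv_along[of g x 0 i] assms
  by (intro partial_deriv_eqI) (auto intro!: derivative_eq_intros)

lemma partial_deriv_mult:
  assumes "f differentiable (at x)" "g differentiable (at x)"
  shows "partial_deriv i (\<lambda>x. f x * g x) x = partial_deriv i f x * g x + f x * partial_deriv i g x"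
  using partial_deriv_along[of f x 0 i] partial_deriv_along[of g x 0 i] assms
  by (intro partial_deriv_eqI) (auto intro!: derivative_eq_intros)

text \<open>The product and chain rules do not lead back into a set of products or compositions, but into sums of
products of its members. Hence coinduction is applied to the algebra generated by a set.\<close>

inductive_set function_algebra :: "('p \<Rightarrow> real ^ 'n \<Rightarrow> real) set \<Rightarrow> ('p \<Rightarrow> real ^ 'n \<Rightarrow> real) set"
  for B where
  base: "F \<in> B \<Longrightarrow> F \<in> function_algebra B"
| add: "F \<in> function_algebra B \<Longrightarrow> G \<in> function_algebra B \<Longrightarrow> (\<lambda>p x. F p x + G p x) \<in> function_algebra B"
| mult: "F \<in> function_algebra B \<Longrightarrow> G \<in> function_algebra B \<Longrightarrow> (\<lambda>p x. F p x * G p x) \<in> function_algebra B"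

lemma smooth_family_function_algebra:
  assumes "F \<in> function_algebra B"
    and cont: "\<And>F. F \<in> B \<Longrightarrow> continuous_on UNIV (\<lambda>(p, x). F p x)"
    and diff: "\<And>F p x. F \<in> B \<Longrightarrow> F p differentiable (at x)"
    and part: "\<And>F i. F \<in> B \<Longrightarrow> (\<lambda>p. partial_deriv i (F p)) \<in> function_algebra B"
  shows "smooth_family F"
proof (rule smooth_family_coinduct[OF assms(1)])
  show d: "F p differentiable (at x)" if "F \<in> function_algebra B" for F p x
    using that by induction (auto intro: diff)
  show "continuous_on UNIV (\<lambda>(p, x). F p x)" if "F \<in> function_algebra B" for F
    using that unfolding case_prod_beta
    by induction (auto intro: cont[unfolded case_prod_beta] continuous_intros)
  show "(\<lambda>p. partial_deriv i (F p)) \<in> function_algebra B" if "F \<in> function_algebra B" for F i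
    using that
  proof induction
    case (base F)
    then show ?case by (rule part)
  next
    case (add F G)
    have "(\<lambda>p. partial_deriv i (\<lambda>x. F p x + G p x)) = (\<lambda>p x. partial_deriv i (F p) x + partial_deriv i (G p) x)"
      using add by (intro ext partial_deriv_add d)
    then show ?case using add by (simp add: function_algebra.add)
  next
    case (mult F G)
    have "(\<lambda>p. partial_deriv i (\<lambda>x. F p x * G p x))
        = (\<lambda>p x. partial_deriv i (F p) x * G p x + F p x * partial_deriv i (G p) x)"
      using mult by (intro ext partial_deriv_mult d)
    then show ?case using mult by (simp add: function_algebra.intros)
  qed
qed

lemma smooth_family_add:
  assumes "smooth_family F" "smooth_family G"
  shows "smooth_family (\<lambda>p x. F p x + G p x)"
  by (rule smooth_family_function_algebra[of _ "Collect smooth_family"])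
     (use assms in \<open>auto intro: function_algebra.intros smooth_family_continuous smooth_family_differentiable
       smooth_family_partial_deriv\<close>)

lemma smooth_family_mult:
  assumes "smooth_family F" "smooth_family G"
  shows "smooth_family (\<lambda>p x. F p x * G p x)"
  by (rule smooth_family_function_algebra[of _ "Collect smooth_family"])
     (use assms in \<open>auto intro: function_algebra.intros smooth_family_continuous smooth_family_differentiable
       smooth_family_partial_deriv\<close>)

lemma smooth_family_parameter:
  assumes "continuous_on UNIV a"
  shows "smooth_family (\<lambda>p x. a p)"
proof (rule smooth_family_coinduct[of _ "{\<lambda>p x. a p |a. continuous_on UNIV a}"])
  fix F :: "'a \<Rightarrow> real ^ 'b \<Rightarrow> real" and p x and i :: 'b
  assume "F \<in> {\<lambda>p x. a p |a. continuous_on UNIV a}"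
  then obtain a where a: "F = (\<lambda>p x. a p)" "continuous_on UNIV a" by blast
  show "continuous_on UNIV (\<lambda>(p, x). F p x)"
    unfolding a case_prod_beta by (rule continuous_on_compose2[OF a(2)]) (auto intro: continuous_intros)
  show "F p differentiable (at x)" by (simp add: a)
  show "(\<lambda>p. partial_deriv i (F p)) \<in> {\<lambda>p x. a p |a. continuous_on UNIV a}"
    unfolding a by (auto intro!: exI[of _ "\<lambda>p. 0"])
qed (use assms in auto)

lemma smooth_family_const: "smooth_family (\<lambda>p x. c)"
  using smooth_family_parameter[of "\<lambda>p. c"] by simp

lemma smooth_family_fixed:
  fixes f :: "real ^ 'n \<Rightarrow> real"
  assumes "smooth_function f"
  shows "smooth_family (\<lambda>p. f)"
  unfolding smooth_family_def
proof (intro allI conjI)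
  fix "is" :: "'n list" and x
  show "iter_partial is f differentiable (at x)"
    using assms unfolding smooth_function_def differentiable_on_def by simp
  have "continuous_on UNIV (iter_partial is f)"
    using assms unfolding smooth_function_def by (intro differentiable_imp_continuous_on) blast
  then show "continuous_on UNIV (\<lambda>(p, x). iter_partial is f x)"
    unfolding case_prod_beta by (rule continuous_on_compose2) (auto intro: continuous_intros)
qed

lemma partial_deriv_component: "partial_deriv i (\<lambda>x :: real ^ 'n. x $ j) = (\<lambda>x. if i = j then 1 else 0)"
proof
  fix x :: "real ^ 'n"
  show "partial_deriv i (\<lambda>x. x $ j) x = (if i = j then 1 else 0)"
    by (rule partial_deriv_eqI) (auto simp: axis_def intro!: derivative_eq_intros)
qed

lemma smooth_function_component: "smooth_function (\<lambda>x :: real ^ 'n. x $ j)"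
proof -
  have "smooth_family (\<lambda>p :: real. \<lambda>x :: real ^ 'n. x $ j)"
  proof (rule smooth_family_coinduct[of _ "insert (\<lambda>p x. x $ j) {\<lambda>p x. c |c. True}"])
    fix F :: "real \<Rightarrow> real ^ 'n \<Rightarrow> real" and p x and i :: 'n
    assume F: "F \<in> insert (\<lambda>p x. x $ j) {\<lambda>p x. c |c. True}"
    show "continuous_on UNIV (\<lambda>(p, x). F p x)"
      using F by (auto simp: case_prod_beta intro!: continuous_intros)
    show "F p differentiable (at x)"
      using F bounded_linear_imp_differentiable[OF bounded_linear_vec_nth] by auto
    show "(\<lambda>p. partial_deriv i (F p)) \<in> insert (\<lambda>p x. x $ j) {\<lambda>p x. c |c. True}"
      using F by (auto simp: partial_deriv_component)
  qed simp
  then show ?thesis by (rule smooth_family_smooth_function)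
qed

lemma differentiable_componentwise:
  fixes \<phi> :: "real ^ 'm \<Rightarrow> real ^ 'n"
  assumes "\<And>j. (\<lambda>x. \<phi> x $ j) differentiable (at x)"
  shows "(\<phi> has_derivative (\<lambda>u. \<chi> j. \<Sum>i\<in>UNIV. u $ i * partial_deriv i (\<lambda>x. \<phi> x $ j) x)) (at x)"
  unfolding has_derivative_componentwise_within[of \<phi>]
proof
  fix b :: "real ^ 'n" assume "b \<in> Basis"
  then obtain j where b: "b = axis j 1" by (auto simp: Basis_vec_def)
  show "((\<lambda>x. \<phi> x \<bullet> b) has_derivative (\<lambda>u. (\<chi> j. \<Sum>i\<in>UNIV. u $ i * partial_deriv i (\<lambda>x. \<phi> x $ j) x) \<bullet> b)) (at x)"
    unfolding b using has_derivative_partials[OF assms[of j]] by (simp add: inner_axis)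
qed

lemma partial_deriv_compose:
  fixes \<phi> :: "real ^ 'm \<Rightarrow> real ^ 'n"
  assumes \<phi>: "\<And>j. (\<lambda>x. \<phi> x $ j) differentiable (at x)" and f: "f differentiable (at (\<phi> x))"
  shows "partial_deriv i (\<lambda>x. f (\<phi> x)) x = (\<Sum>j\<in>UNIV. partial_deriv j f (\<phi> x) * partial_deriv i (\<lambda>x. \<phi> x $ j) x)"
proof -
  have d: "((\<lambda>x. f (\<phi> x)) has_derivative (\<lambda>u. \<Sum>j\<in>UNIV.
     (\<Sum>i\<in>UNIV. u $ i * partial_deriv i (\<lambda>x. \<phi> x $ j) x) * partial_deriv j f (\<phi> x))) (at x)"
    using has_derivative_compose[OF differentiable_componentwise[OF \<phi>] has_derivative_partials[OF f]] by simp
  then have "(\<lambda>x. f (\<phi> x)) differentiable (at x)" unfolding differentiable_def by blast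
  from has_derivative_partials[OF this] d
  have eq: "(\<lambda>u. \<Sum>i\<in>UNIV. u $ i * partial_deriv i (\<lambda>x. f (\<phi> x)) x) = (\<lambda>u. \<Sum>j\<in>UNIV.
     (\<Sum>i\<in>UNIV. u $ i * partial_deriv i (\<lambda>x. \<phi> x $ j) x) * partial_deriv j f (\<phi> x))"
    by (rule has_derivative_unique)
  show ?thesis
    using fun_cong[OF eq, of "1 *\<^sub>R axis i 1"] unfolding sum_axis_mult by (simp add: mult.commute)
qed

lemma smooth_family_compose:
  fixes F :: "'p::topological_space \<Rightarrow> real ^ 'n \<Rightarrow> real" and \<phi> :: "'p \<Rightarrow> real ^ 'm \<Rightarrow> real ^ 'n"
  assumes F: "smooth_family F" and \<phi>: "\<And>j. smooth_family (\<lambda>p x. \<phi> p x $ j)"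
  shows "smooth_family (\<lambda>p x. F p (\<phi> p x))"
proof -
  define B where "B = {\<lambda>p x. F p (\<phi> p x) |F. smooth_family F} \<union> Collect smooth_family"
  have \<phi>c: "continuous_on UNIV (\<lambda>q. \<phi> (fst q) (snd q))"
  proof -
    have "continuous_on UNIV (\<lambda>q. \<chi> j. \<phi> (fst q) (snd q) $ j)"
      using smooth_family_continuous[OF \<phi>] by (intro continuous_on_vec_lambda) (simp add: case_prod_beta)
    then show ?thesis by simp
  qed
  have \<phi>d: "(\<lambda>x. \<phi> p x $ j) differentiable (at x)" for p x j
    by (rule smooth_family_differentiable[OF \<phi>])
  show ?thesis
  proof (rule smooth_family_function_algebra[of _ B])
    show "(\<lambda>p x. F p (\<phi> p x)) \<in> function_algebra B"
      using F by (auto simp: B_def intro!: function_algebra.base)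
  next
    fix G :: "'p \<Rightarrow> real ^ 'm \<Rightarrow> real" assume "G \<in> B"
    then consider F where "smooth_family F" "G = (\<lambda>p x. F p (\<phi> p x))" | "smooth_family G"
      unfolding B_def by blast
    then show "continuous_on UNIV (\<lambda>(p, x). G p x)"
    proof cases
      case 1
      have "continuous_on UNIV (\<lambda>q. (fst q, \<phi> (fst q) (snd q)))"
        by (intro continuous_intros \<phi>c)
      from continuous_on_compose2[OF smooth_family_continuous[OF 1(1)] this] show ?thesis
        by (simp add: 1(2) case_prod_beta)
    qed (rule smooth_family_continuous)
  next
    fix G :: "'p \<Rightarrow> real ^ 'm \<Rightarrow> real" and p x assume "G \<in> B"
    then consider F where "smooth_family F" "G = (\<lambda>p x. F p (\<phi> p x))" | "smooth_family G"
      unfolding B_def by blast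
    then show "G p differentiable (at x)"
    proof cases
      case 1
      show ?thesis
        unfolding 1(2) differentiable_def
        using has_derivative_compose[OF differentiable_componentwise[OF \<phi>d]
          has_derivative_partials[OF smooth_family_differentiable[OF 1(1)]]] by blast
    qed (rule smooth_family_differentiable)
  next
    fix G :: "'p \<Rightarrow> real ^ 'm \<Rightarrow> real" and i assume "G \<in> B"
    then consider F where "smooth_family F" "G = (\<lambda>p x. F p (\<phi> p x))" | "smooth_family G"
      unfolding B_def by blast
    then show "(\<lambda>p. partial_deriv i (G p)) \<in> function_algebra B"
    proof cases
      case 1
      have "(\<lambda>p x. \<Sum>j\<in>J. partial_deriv j (F p) (\<phi> p x) * partial_deriv i (\<lambda>x. \<phi> p x $ j) x) \<in> function_algebra B"
        for J
      proof (induction J rule: infinite_finite_induct)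
        case (insert j J)
        have "(\<lambda>p x. partial_deriv j (F p) (\<phi> p x)) \<in> function_algebra B"
          using smooth_family_partial_deriv[OF 1(1)] by (auto simp: B_def intro!: function_algebra.base)
        moreover have "(\<lambda>p x. partial_deriv i (\<lambda>x. \<phi> p x $ j) x) \<in> function_algebra B"
          using smooth_family_partial_deriv[OF \<phi>] by (auto simp: B_def intro!: function_algebra.base)
        ultimately show ?case
          using insert by (simp add: function_algebra.add function_algebra.mult)
      qed (auto simp: B_def smooth_family_const intro!: function_algebra.base)
      moreover have "(\<lambda>p. partial_deriv i (G p)) =
          (\<lambda>p x. \<Sum>j\<in>UNIV. partial_deriv j (F p) (\<phi> p x) * partial_deriv i (\<lambda>x. \<phi> p x $ j) x)"
        unfolding 1(2) by (intro ext partial_deriv_compose \<phi>d smooth_family_differentiable 1(1))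
      ultimately show ?thesis by simp
    next
      case 2
      then show ?thesis
        using smooth_family_partial_deriv by (auto simp: B_def intro!: function_algebra.base)
    qed
  qed
qed

section \<open>Entire functions with bounded exponential coefficients\<close>

text \<open>Shifting the coefficient sequence differentiates the series, and coefficients bounded by 1 make it
entire.\<close>

definition exp_series :: "(nat \<Rightarrow> real) \<Rightarrow> real \<Rightarrow> real"
  where "exp_series b y = (\<Sum>n. b n / fact n * y ^ n)"

lemma exp_series_summable:
  fixes y :: real
  assumes "\<And>n. \<bar>b n\<bar> \<le> 1"
  shows "summable (\<lambda>n. b n / fact n * y ^ n)"
proof (rule summable_comparison_test[OF _ summable_exp[of "\<bar>y\<bar>"]], intro exI[of _ 0] allI impI)
  show "norm (b n / fact n * y ^ n) \<le> inverse (fact n) * \<bar>y\<bar> ^ n" for n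
    using mult_right_mono[OF assms[of n], of "\<bar>y\<bar> ^ n / fact n"]
    by (simp add: abs_mult power_abs field_simps)
qed

lemma exp_series_has_derivative:
  assumes "\<And>n. \<bar>b n\<bar> \<le> 1"
  shows "(exp_series b has_field_derivative exp_series (\<lambda>n. b (Suc n)) y) (at y)"
proof -
  have "(exp_series b has_field_derivative (\<Sum>n. diffs (\<lambda>n. b n / fact n) n * y ^ n)) (at y)"
    unfolding exp_series_def[abs_def]
    by (intro termdiffs_strong_converges_everywhere exp_series_summable assms)
  moreover have "diffs (\<lambda>n. b n / fact n) = (\<lambda>n. b (Suc n) / fact n)"
    by (auto simp: diffs_def fun_eq_iff field_simps simp del: of_nat_Suc)
  ultimately show ?thesis by (simp add: exp_series_def)
qed

lemma exp_series_0: "exp_series b 0 = b 0"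
  using powser_zero[of "\<lambda>n. b n / fact n"] by (simp add: exp_series_def)

text \<open>The \<open>m\<close>-th derivative at 0 is the \<open>m\<close>-th coefficient.\<close>

lemma exp_series_inject:
  assumes "\<And>n. \<bar>b n\<bar> \<le> 1" "\<And>n. \<bar>c n\<bar> \<le> 1" "exp_series b = exp_series c"
  shows "b = c"
proof -
  have "exp_series (\<lambda>n. b (n + m)) = exp_series (\<lambda>n. c (n + m))" for m
  proof (induction m)
    case (Suc m)
    have "exp_series (\<lambda>n. b (Suc n + m)) y = exp_series (\<lambda>n. c (Suc n + m)) y" for y
      using exp_series_has_derivative[of "\<lambda>n. b (n + m)" y] exp_series_has_derivative[of "\<lambda>n. c (n + m)" y]
        assms(1,2) Suc by (metis DERIV_unique)
    then show ?case by (simp add: fun_eq_iff)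
  qed (use assms in simp)
  then have "b m = c m" for m using exp_series_0[of "\<lambda>n. b (n + m)"] exp_series_0[of "\<lambda>n. c (n + m)"] by simp
  then show ?thesis by blast
qed

lemma exp_series_continuous:
  fixes b :: "nat \<Rightarrow> 'p::topological_space \<Rightarrow> real" and y :: "'q::topological_space \<Rightarrow> real"
  assumes b: "\<And>n. continuous_on UNIV (b n)" "\<And>n p. \<bar>b n p\<bar> \<le> 1" and y: "continuous_on UNIV y"
  shows "continuous_on UNIV (\<lambda>(p, x). exp_series (\<lambda>n. b n p) (y x))"
proof -
  have "continuous_on {q. \<bar>y (snd q)\<bar> < R} (\<lambda>q. exp_series (\<lambda>n. b n (fst q)) (y (snd q)))" for R
  proof (rule uniform_limit_theorem)
    show "uniform_limit {q. \<bar>y (snd q)\<bar> < R} (\<lambda>N q. \<Sum>n<N. b n (fst q) / fact n * y (snd q) ^ n)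
        (\<lambda>q. exp_series (\<lambda>n. b n (fst q)) (y (snd q))) sequentially"
      unfolding exp_series_def
    proof (rule Weierstrass_m_test)
      show "summable (\<lambda>n. inverse (fact n) * \<bar>R\<bar> ^ n)" by (rule summable_exp)
      fix n and q :: "'p \<times> 'q" assume q: "q \<in> {q. \<bar>y (snd q)\<bar> < R}"
      have "\<bar>b n (fst q)\<bar> * \<bar>y (snd q)\<bar> ^ n \<le> 1 * \<bar>R\<bar> ^ n"
        using q b(2) by (intro mult_mono power_mono) auto
      then show "norm (b n (fst q) / fact n * y (snd q) ^ n) \<le> inverse (fact n) * \<bar>R\<bar> ^ n"
        by (simp add: abs_mult power_abs field_simps)
    qed
    show "\<forall>\<^sub>F N in sequentially. continuous_on {q. \<bar>y (snd q)\<bar> < R} (\<lambda>q. \<Sum>n<N. b n (fst q) / fact n * y (snd q) ^ n)"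
      by (intro always_eventually allI continuous_intros
          continuous_on_compose2[OF b(1)] continuous_on_compose2[OF y]) auto
  qed simp
  moreover have "open {q :: 'p \<times> 'q. \<bar>y (snd q)\<bar> < R}" for R
    by (intro open_Collect_less continuous_intros continuous_on_compose2[OF y]) auto
  ultimately have "continuous_on (\<Union>R. {q. \<bar>y (snd q)\<bar> < R}) (\<lambda>q. exp_series (\<lambda>n. b n (fst q)) (y (snd q)))"
    by (intro continuous_on_open_UN)
  moreover have "(\<Union>R. {q :: 'p \<times> 'q. \<bar>y (snd q)\<bar> < R}) = UNIV"
    using gt_ex by auto
  ultimately show ?thesis by (simp add: case_prod_beta)
qed

text \<open>The class of all these families, for all continuous coefficient sequences bounded by 1, is closed under
partial derivatives: they shift the coefficients or annihilate the function.\<close>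

lemma smooth_family_exp_series:
  fixes b :: "nat \<Rightarrow> 'p::topological_space \<Rightarrow> real"
  assumes "\<And>n. continuous_on UNIV (b n)" "\<And>n p. \<bar>b n p\<bar> \<le> 1"
  shows "smooth_family (\<lambda>p x :: real ^ 'n. exp_series (\<lambda>n. b n p) (x $ k - z))"
proof (rule smooth_family_coinduct[where S = "{\<lambda>p x. exp_series (\<lambda>n. b n p) (x $ k - z) |b.
      \<forall>n. continuous_on UNIV (b n) \<and> (\<forall>p. \<bar>b n p\<bar> \<le> 1)}"])
  fix F :: "'p \<Rightarrow> real ^ 'n \<Rightarrow> real" and p x i
  assume "F \<in> {\<lambda>p x. exp_series (\<lambda>n. b n p) (x $ k - z) |b. \<forall>n. continuous_on UNIV (b n) \<and> (\<forall>p. \<bar>b n p\<bar> \<le> 1)}"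
  then obtain b where F: "F = (\<lambda>p x. exp_series (\<lambda>n. b n p) (x $ k - z))"
    and b: "\<And>n. continuous_on UNIV (b n)" "\<And>n p. \<bar>b n p\<bar> \<le> 1" by blast
  show "continuous_on UNIV (\<lambda>(p, x). F p x)"
    unfolding F by (intro exp_series_continuous b continuous_intros)
  have l: "((\<lambda>x. x $ k - z) has_derivative (\<lambda>u. u $ k)) (at x)" for x :: "real ^ 'n"
    by (auto intro!: derivative_eq_intros bounded_linear_imp_has_derivative bounded_linear_vec_nth)
  have d: "(F p has_derivative (\<lambda>u. exp_series (\<lambda>n. b (Suc n) p) (x $ k - z) * u $ k)) (at x)" for p x
    unfolding F using has_derivative_compose[OF l
      exp_series_has_derivative[of "\<lambda>n. b n p", OF b(2), unfolded has_field_derivative_def]] by simp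
  then show "F p differentiable (at x)" unfolding differentiable_def by blast
  have "(\<lambda>p. partial_deriv i (F p)) = (\<lambda>p x. exp_series (\<lambda>n. if i = k then b (Suc n) p else 0) (x $ k - z))"
  proof (intro ext)
    fix p x
    have "F p differentiable (at x)" using d unfolding differentiable_def by blast
    from has_derivative_partials[OF this] d
    have eq: "(\<lambda>u. \<Sum>i\<in>UNIV. u $ i * partial_deriv i (F p) x) =
       (\<lambda>u. exp_series (\<lambda>n. b (Suc n) p) (x $ k - z) * u $ k)"
      by (rule has_derivative_unique)
    show "partial_deriv i (F p) x = exp_series (\<lambda>n. if i = k then b (Suc n) p else 0) (x $ k - z)"
      using fun_cong[OF eq, of "1 *\<^sub>R axis i 1"] unfolding sum_axis_mult
      by (cases "i = k") (simp_all add: axis_def exp_series_def)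
  qed
  then show "(\<lambda>p. partial_deriv i (F p)) \<in> {\<lambda>p x. exp_series (\<lambda>n. b n p) (x $ k - z) |b.
      \<forall>n. continuous_on UNIV (b n) \<and> (\<forall>p. \<bar>b n p\<bar> \<le> 1)}"
    using b by (intro CollectI exI[of _ "\<lambda>n p. if i = k then b (Suc n) p else 0"]) (cases "i = k"; auto)
qed (use assms in blast)

section \<open>Smooth families are continuous in the \<open>C\<^sup>k\<close> topology\<close>

text \<open>A basic neighbourhood restricts finitely many derivatives on a compact set. Joint continuity of each
derivative makes it uniformly close on the compact set for all nearby parameters.\<close>

lemma continuous_map_into_Ck_topology:
  fixes G :: "'p::topological_space \<Rightarrow> 'n::finite metric_field"
  assumes G: "\<And>i j. smooth_family (\<lambda>p x. G p x $ i $ j)" and M: "G ` Q \<subseteq> M"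
  shows "continuous_map (top_of_set Q) (Ck_topology k M) G"
  unfolding continuous_map
proof (intro conjI allI impI)
  show "G ` topspace (top_of_set Q) \<subseteq> topspace (Ck_topology k M)" using M by simp
  fix U assume "openin (Ck_topology k M) U"
  then have U: "\<And>g. g \<in> U \<Longrightarrow> \<exists>N C e. enat N \<le> k \<and> compact C \<and> e > 0 \<and> Ck_nbhd M N C e g \<subseteq> U"
    unfolding openin_Ck_topology by blast
  show "openin (top_of_set Q) {p \<in> topspace (top_of_set Q). G p \<in> U}"
  proof (subst openin_subopen, intro ballI)
    fix p assume p: "p \<in> {p \<in> topspace (top_of_set Q). G p \<in> U}"
    then obtain N C e where C: "compact C" and e: "e > 0" and sub: "Ck_nbhd M N C e (G p) \<subseteq> U"
      using U by blast
    define D where "D = (\<lambda>(i, j, is) q x. iter_partial is (\<lambda>y. G q y $ i $ j) x :: real)"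
    let ?I = "(UNIV :: 'n set) \<times> (UNIV :: 'n set) \<times> {is :: 'n list. length is \<le> N}"
    have "\<exists>V. open V \<and> p \<in> V \<and> (\<forall>q\<in>V. \<forall>x\<in>C. \<bar>D a q x - D a p x\<bar> < e)" for a
    proof -
      obtain i j "is" where a: "a = (i, j, is)" by (metis prod_cases3)
      have "continuous_on UNIV (\<lambda>(q, x). D a q x)"
        using G unfolding D_def a smooth_family_def by simp
      then have "continuous_on (UNIV \<times> C) (\<lambda>(q, x). D a q x)"
        by (rule continuous_on_subset) simp
      then obtain V where "p \<in> V" "open V"
         "\<forall>q\<in>V \<inter> UNIV. \<forall>x\<in>C. dist ((\<lambda>(q, x). D a q x) (q, x)) ((\<lambda>(q, x). D a q x) (p, x)) \<le> e / 2"
        by (rule continuous_on_prod_compactE[of UNIV C _ p "e / 2"]) (use C e in auto)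
      then show ?thesis using e by (intro exI[of _ V]) (fastforce simp: dist_real_def)
    qed
    then obtain V where V: "\<And>a. open (V a)" "\<And>a. p \<in> V a"
      "\<And>a q x. q \<in> V a \<Longrightarrow> x \<in> C \<Longrightarrow> \<bar>D a q x - D a p x\<bar> < e"
      by metis
    \<comment> \<open>Only finitely many derivatives occur, so the neighbourhoods \<open>V a\<close> can be intersected.\<close>
    have fin: "finite ?I"
      using finite_lists_length_le[of "UNIV :: 'n set" N] by (intro finite_cartesian_product finite_class.finite_UNIV) auto
    let ?V = "Q \<inter> (\<Inter>a\<in>?I. V a)"
    have "open (\<Inter>a\<in>?I. V a)" using fin V(1) by blast
    then have "openin (top_of_set Q) ?V" by (rule openin_open_Int)
    moreover have "p \<in> ?V" using p V(2) by auto
    moreover have "?V \<subseteq> {p \<in> topspace (top_of_set Q). G p \<in> U}"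
    proof
      fix q assume q: "q \<in> ?V"
      have "\<bar>iter_partial is (\<lambda>y. G q y $ i $ j) x - iter_partial is (\<lambda>y. G p y $ i $ j) x\<bar> < e"
        if "x \<in> C" "length is \<le> N" for x i j "is"
        using V(3)[of q "(i, j, is)" x] q that by (auto simp: D_def)
      then have "G q \<in> Ck_nbhd M N C e (G p)"
        unfolding Ck_nbhd_def using q M by auto
      then show "q \<in> {p \<in> topspace (top_of_set Q). G p \<in> U}" using sub q by auto
    qed
    ultimately show "\<exists>T. openin (top_of_set Q) T \<and> p \<in> T \<and> T \<subseteq> {p \<in> topspace (top_of_set Q). G p \<in> U}"
      by blast
  qed
qed

text \<open>Evaluation at a point is continuous already for \<open>C\<^sup>0\<close> convergence, hence in every \<open>C\<^sup>k\<close> topology.\<close>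

lemma openin_Ck_topology_point_value:
  assumes "open S"
  shows "openin (Ck_topology k M) {h \<in> M. h x $ i $ j \<in> S}"
  unfolding openin_Ck_topology
proof (intro conjI ballI)
  fix g assume g: "g \<in> {h \<in> M. h x $ i $ j \<in> S}"
  then obtain e where e: "e > 0" "\<And>y. dist y (g x $ i $ j) < e \<Longrightarrow> y \<in> S"
    using assms unfolding open_dist by blast
  have "Ck_nbhd M 0 {x} e g \<subseteq> {h \<in> M. h x $ i $ j \<in> S}"
  proof
    fix h assume h: "h \<in> Ck_nbhd M 0 {x} e g"
    then have "\<bar>iter_partial [] (\<lambda>y. h y $ i $ j) x - iter_partial [] (\<lambda>y. g y $ i $ j) x\<bar> < e"
      unfolding Ck_nbhd_def by blast
    then show "h \<in> {h \<in> M. h x $ i $ j \<in> S}"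
      using h e(2) by (auto simp: Ck_nbhd_def dist_real_def)
  qed
  then show "\<exists>N C e. enat N \<le> k \<and> compact C \<and> e > 0 \<and> Ck_nbhd M N C e g \<subseteq> {h \<in> M. h x $ i $ j \<in> S}"
    using e(1) by (intro exI[of _ 0] exI[of _ "{x}"] exI[of _ e]) (simp add: zero_enat_def[symmetric])
qed auto

lemma Hausdorff_space_Ck_topology: "Hausdorff_space (Ck_topology k M)"
  unfolding Hausdorff_space_def
proof (intro allI impI)
  fix g h assume gh: "g \<in> topspace (Ck_topology k M) \<and> h \<in> topspace (Ck_topology k M) \<and> g \<noteq> h"
  then obtain x i j where ne: "g x $ i $ j \<noteq> h x $ i $ j" by (auto simp: fun_eq_iff vec_eq_iff)
  obtain S T where ST: "open S" "open T" "g x $ i $ j \<in> S" "h x $ i $ j \<in> T" "S \<inter> T = {}"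
    using hausdorff[OF ne] by blast
  let ?V = "\<lambda>S. {h \<in> M. h x $ i $ j \<in> S}"
  have "openin (Ck_topology k M) (?V S)" "openin (Ck_topology k M) (?V T)"
    by (rule openin_Ck_topology_point_value[OF ST(1)], rule openin_Ck_topology_point_value[OF ST(2)])
  moreover have "g \<in> ?V S" "h \<in> ?V T" using ST gh by auto
  moreover have "disjnt (?V S) (?V T)" using ST(5) unfolding disjnt_def by blast
  ultimately show "\<exists>U V. openin (Ck_topology k M) U \<and> openin (Ck_topology k M) V \<and> g \<in> U \<and> h \<in> V \<and> disjnt U V"
    by blast
qed

section \<open>Shears, zooms and constant metrics\<close>

text \<open>The pull-back of \<open>g\<close> under \<open>shear h\<close>, where \<open>h'\<close> is meant to be the derivative of \<open>h\<close>. It is a separate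
argument so that smoothness in a parameter can be asked of \<open>h\<close> and \<open>h'\<close> directly.\<close>

definition sheared_metric :: "(real \<Rightarrow> real) \<Rightarrow> (real \<Rightarrow> real) \<Rightarrow> 2 metric_field \<Rightarrow> 2 metric_field"
  where "sheared_metric h h' g x = (let A = g (shear h x); c = h' (x $ 1) in
    vector [vector [A $ 1 $ 1 + 2 * c * A $ 1 $ 2 + c\<^sup>2 * A $ 2 $ 2, A $ 1 $ 2 + c * A $ 2 $ 2],
            vector [A $ 1 $ 2 + c * A $ 2 $ 2, A $ 2 $ 2]])"

lemma sheared_metric_nth:
  "sheared_metric h h' g x $ 1 $ 1 =
     g (shear h x) $ 1 $ 1 + 2 * h' (x $ 1) * g (shear h x) $ 1 $ 2 + (h' (x $ 1))\<^sup>2 * g (shear h x) $ 2 $ 2"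
  "sheared_metric h h' g x $ 1 $ 2 = g (shear h x) $ 1 $ 2 + h' (x $ 1) * g (shear h x) $ 2 $ 2"
  "sheared_metric h h' g x $ 2 $ 1 = g (shear h x) $ 1 $ 2 + h' (x $ 1) * g (shear h x) $ 2 $ 2"
  "sheared_metric h h' g x $ 2 $ 2 = g (shear h x) $ 2 $ 2"
  by (simp_all add: sheared_metric_def Let_def)

lemma metric_inner_sheared:
  assumes "riemannian_metric g"
  shows "metric_inner (sheared_metric h h' g) x u v = metric_inner g (shear h x)
    (u + (h' (x $ 1) * u $ 1) *\<^sub>R axis 2 1) (v + (h' (x $ 1) * v $ 1) *\<^sub>R axis 2 1)"
  unfolding metric_inner_2 sheared_metric_nth riemannian_metric_2(1)[OF assms]
  by (simp add: axis_def power2_eq_square algebra_simps)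

lemma smooth_family_sheared_metric:
  assumes G: "\<And>i j. smooth_family (\<lambda>p x. G p x $ i $ j)"
    and h: "smooth_family (\<lambda>p x :: real ^ 2. h p (x $ 1))" and h': "smooth_family (\<lambda>p x :: real ^ 2. h' p (x $ 1))"
  shows "smooth_family (\<lambda>p x. sheared_metric (h p) (h' p) (G p) x $ i $ j)"
proof -
  have s: "smooth_family (\<lambda>p x. shear (h p) x $ k)" for k
    using exhaust_2[of k] smooth_family_fixed[OF smooth_function_component[of "1::2"]]
      smooth_family_add[OF smooth_family_fixed[OF smooth_function_component[of "2::2"]] h] by auto
  note c = smooth_family_compose[OF G s]
  show ?thesis
    using exhaust_2[of i] exhaust_2[of j]
    by (auto simp: sheared_metric_nth power2_eq_square
        intro!: smooth_family_add smooth_family_mult smooth_family_const c h')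
qed

lemma riemannian_metric_sheared:
  assumes g: "riemannian_metric g" and s: "\<And>i j. smooth_function (\<lambda>x. sheared_metric h h' g x $ i $ j)"
  shows "riemannian_metric (sheared_metric h h' g)"
  unfolding riemannian_metric_def
proof (intro conjI allI impI s)
  fix x u v
  show "metric_inner (sheared_metric h h' g) x u v = metric_inner (sheared_metric h h' g) x v u"
    unfolding metric_inner_sheared[OF g] by (rule riemannian_metric_symmetric[OF g])
  assume v: "v \<noteq> (0 :: real ^ 2)"
  have "v + (h' (x $ 1) * v $ 1) *\<^sub>R axis 2 1 \<noteq> 0"
    using v by (auto simp: vec_eq_iff forall_2 axis_def)
  then show "metric_inner (sheared_metric h h' g) x v v > 0"
    unfolding metric_inner_sheared[OF g] by (rule riemannian_metric_pos[OF g])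
qed

lemma sheared_metric_complete_nonneg:
  assumes g: "g \<in> complete_nonneg_metrics"
    and s: "\<And>i j. smooth_function (\<lambda>x. sheared_metric h h1 g x $ i $ j)"
    and h: "\<And>s. (h has_field_derivative h1 s) (at s)" "\<And>s. (h1 has_field_derivative h2 s) (at s)"
  shows "sheared_metric h h1 g \<in> complete_nonneg_metrics"
proof -
  have r: "riemannian_metric g" and c: "complete_metric g" and nn: "nonneg_curved g"
    using g by (auto simp: complete_nonneg_metrics_def)
  have r': "riemannian_metric (sheared_metric h h1 g)" by (rule riemannian_metric_sheared[OF r s])
  have h1c: "continuous_on UNIV h1"
    using h(2) by (meson DERIV_continuous continuous_at_imp_continuous_on)
  have hm: "((\<lambda>s. - h s) has_field_derivative - h1 s) (at s)" for s
    by (rule DERIV_minus[OF h(1)])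
  have cont: "continuous_on UNIV (\<lambda>(x :: real ^ 2, u :: real ^ 2). u + (c * h1 (x $ 1) * u $ 1) *\<^sub>R axis (2::2) (1::real))" for c
    unfolding case_prod_beta
    by (intro continuous_intros continuous_on_compose2[OF h1c]) auto
  have "complete_metric (sheared_metric h h1 g)"
  proof (rule complete_metric_pullback[OF r r' c has_derivative_shear[OF h(1)] _ has_derivative_shear[OF hm], where c = 1])
    show "continuous_on UNIV (\<lambda>(x :: real ^ 2, u :: real ^ 2). u + (h1 (x $ 1) * u $ 1) *\<^sub>R axis 2 1)"
      using cont[of 1] by simp
    show "continuous_on UNIV (\<lambda>(x :: real ^ 2, u :: real ^ 2). u + (- h1 (x $ 1) * u $ 1) *\<^sub>R axis 2 1)"
      using cont[of "-1"] by simp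
    show "shear (\<lambda>s. - h s) (shear h x) = x" "shear h (shear (\<lambda>s. - h s) x) = x" for x
      by (simp_all add: vec_eq_iff forall_2)
  qed (simp_all add: metric_inner_sheared[OF r])
  moreover have "nonneg_curved (sheared_metric h h1 g)"
  proof -
    have sm: "smooth_function (\<lambda>x. g x $ i $ j)" for i j
      using r unfolding riemannian_metric_def by blast
    show ?thesis
      using nn unfolding nonneg_curved_iff_gauss_num[OF r] nonneg_curved_iff_gauss_num[OF r']
      unfolding sheared_metric_nth gauss_num_shear[OF sm sm sm h] by blast
  qed
  ultimately show ?thesis using r' by (simp add: complete_nonneg_metrics_def)
qed

lemma sheared_metric_0:
  assumes "riemannian_metric g" "\<And>s. h s = 0" "\<And>s. h' s = 0"
  shows "sheared_metric h h' g = g"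
proof
  fix x
  have s: "shear h x = x" using assms by (simp add: vec_eq_iff forall_2)
  have "sheared_metric h h' g x $ i $ j = g x $ i $ j" for i j
    using exhaust_2[of i] exhaust_2[of j] riemannian_metric_2(1)[OF assms(1), of x]
    by (auto simp: sheared_metric_nth s assms)
  then show "sheared_metric h h' g x = g x" by (simp add: vec_eq_iff)
qed

definition zoomed_metric :: "real \<Rightarrow> real ^ 'n \<Rightarrow> real \<Rightarrow> 'n metric_field \<Rightarrow> 'n metric_field"
  where "zoomed_metric c z t g x = c *\<^sub>R g (z + t *\<^sub>R (x - z))"

lemma metric_inner_zoomed: "metric_inner (zoomed_metric c z t g) x u v = c * metric_inner g (z + t *\<^sub>R (x - z)) u v"
  unfolding metric_inner_eq_sum zoomed_metric_def by (simp add: sum_distrib_left algebra_simps)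

lemma smooth_family_zoom:
  fixes f :: "real ^ 'n \<Rightarrow> real"
  assumes "smooth_function f" "continuous_on UNIV t"
  shows "smooth_family (\<lambda>p x. f (z + t p *\<^sub>R (x - z)))"
proof (rule smooth_family_compose[OF smooth_family_fixed[OF assms(1)]])
  fix j
  have "smooth_family (\<lambda>p x. z $ j + t p * (x $ j + - z $ j))"
    by (intro smooth_family_add smooth_family_mult smooth_family_const smooth_family_parameter assms
        smooth_family_fixed smooth_function_component)
  then show "smooth_family (\<lambda>p x. (z + t p *\<^sub>R (x - z)) $ j)" by simp
qed

text \<open>The zoom is \<open>c / t\<^sup>2\<close> times the pull-back under the homothety with centre \<open>z\<close> and factor \<open>t\<close>.\<close>

lemma zoomed_metric_complete_nonneg:
  fixes g :: "2 metric_field"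
  assumes g: "g \<in> complete_nonneg_metrics" and c: "c > 0" and t: "t > 0"
  shows "zoomed_metric c z t g \<in> complete_nonneg_metrics"
proof -
  have r: "riemannian_metric g" and co: "complete_metric g" and nn: "nonneg_curved g"
    using g by (auto simp: complete_nonneg_metrics_def)
  have sm: "smooth_function (\<lambda>x. g x $ i $ j)" for i j
    using r unfolding riemannian_metric_def by blast
  have r': "riemannian_metric (zoomed_metric c z t g)"
    unfolding riemannian_metric_def metric_inner_zoomed
  proof (intro conjI allI impI)
    fix i j
    have "smooth_family (\<lambda>(p::real) x. c * g (z + t *\<^sub>R (x - z)) $ i $ j)"
      by (intro smooth_family_mult smooth_family_const smooth_family_zoom sm continuous_intros)
    from smooth_family_smooth_function[OF this]
    show "smooth_function (\<lambda>x. zoomed_metric c z t g x $ i $ j)"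
      by (simp add: zoomed_metric_def)
  qed (use c riemannian_metric_symmetric[OF r] riemannian_metric_pos[OF r] in auto)
  have "complete_metric (zoomed_metric c z t g)"
  proof (rule complete_metric_pullback[OF r r' co, where c = "c / t\<^sup>2"])
    show "((\<lambda>x. z + t *\<^sub>R (x - z)) has_derivative (\<lambda>u. t *\<^sub>R u)) (at x)" for x
      by (auto intro!: derivative_eq_intros)
    show "((\<lambda>x. z + (1 / t) *\<^sub>R (x - z)) has_derivative (\<lambda>u. (1 / t) *\<^sub>R u)) (at x)" for x
      by (auto intro!: derivative_eq_intros)
  qed (use c t in \<open>auto simp: metric_inner_zoomed metric_inner_scale case_prod_beta intro!: continuous_intros\<close>)
  moreover have "nonneg_curved (zoomed_metric c z t g)"
    using nn c t gauss_num_zoom[OF sm[of 1 1] sm[of 1 2] sm[of 2 2], of c z t]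
    unfolding nonneg_curved_iff_gauss_num[OF r] nonneg_curved_iff_gauss_num[OF r']
    by (simp add: zoomed_metric_def)
  ultimately show ?thesis using r' by (simp add: complete_nonneg_metrics_def)
qed

text \<open>A constant metric is flat, and it is the pull-back of the Euclidean metric under the upper triangular
Cholesky factor of its matrix.\<close>

lemma constant_metric_complete_nonneg:
  fixes A :: "real ^ 2 ^ 2"
  assumes r: "riemannian_metric (\<lambda>x. A)"
  shows "(\<lambda>x. A) \<in> complete_nonneg_metrics"
proof -
  have E: "riemannian_metric (\<lambda>x. mat 1 :: real ^ 2 ^ 2)"
    unfolding riemannian_metric_def metric_inner_Euclidean
    using smooth_family_smooth_function[OF smooth_family_const]
    by (auto simp: inner_commute)
  define e f d where "e = A $ 1 $ 1" and "f = A $ 1 $ 2" and "d = A $ 1 $ 1 * A $ 2 $ 2 - (A $ 1 $ 2)\<^sup>2"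
  have pos: "e > 0" "d > 0" using riemannian_metric_2[OF r] by (simp_all add: e_def d_def)
  have A22: "A $ 2 $ 2 = f\<^sup>2 / e + d / e" using pos by (simp add: d_def e_def f_def field_simps)
  define L :: "real ^ 2 \<Rightarrow> real ^ 2"
    where "L u = vector [sqrt e * u $ 1 + f / sqrt e * u $ 2, sqrt (d / e) * u $ 2]" for u
  define M :: "real ^ 2 \<Rightarrow> real ^ 2"
    where "M w = vector [(w $ 1 - f / sqrt e * (w $ 2 / sqrt (d / e))) / sqrt e, w $ 2 / sqrt (d / e)]" for w
  have lin: "bounded_linear L" "bounded_linear M"
    unfolding linear_conv_bounded_linear[symmetric]
    by (intro linearI; simp add: L_def M_def vec_eq_iff forall_2 algebra_simps add_divide_distrib diff_divide_distrib)+
  have "complete_metric (\<lambda>x. A)"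
  proof (rule complete_metric_pullback[OF E r complete_metric_Euclidean[OF E], where c = 1])
    show "(L has_derivative L) (at x)" "(M has_derivative M) (at x)" for x
      using lin by (simp_all add: bounded_linear_imp_has_derivative)
    show "continuous_on UNIV (\<lambda>(x :: real ^ 2, u). L u)" "continuous_on UNIV (\<lambda>(x :: real ^ 2, u). M u)"
      unfolding case_prod_beta
      by (intro bounded_linear.continuous_on[OF lin(1)] bounded_linear.continuous_on[OF lin(2)] continuous_intros)+
    show "M (L x) = x" "L (M x) = x" for x
      using pos by (simp_all add: L_def M_def vec_eq_iff forall_2)
    have "e * (u $ 1)\<^sup>2 + 2 * f * (u $ 1 * u $ 2) + (f\<^sup>2 / e + d / e) * (u $ 2)\<^sup>2
        = (sqrt e * u $ 1 + f / sqrt e * u $ 2)\<^sup>2 + (sqrt (d / e) * u $ 2)\<^sup>2" for u :: "real ^ 2"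
      using pos by (simp add: power2_sum power_mult_distrib power_divide algebra_simps)
    then show "metric_inner (\<lambda>x. A) x u u = 1 * metric_inner (\<lambda>x. mat 1) (L x) (L u) (L u)" for x u
      unfolding metric_inner_Euclidean inner_vec_def sum_2 metric_inner_2 riemannian_metric_2(1)[OF r] A22 L_def
        e_def[symmetric] f_def[symmetric]
      by (simp add: power2_eq_square algebra_simps)
  qed simp
  moreover have "nonneg_curved (\<lambda>x. A)"
    unfolding nonneg_curved_iff_gauss_num[OF r] by (simp add: gauss_num_def gauss_jet_def)
  ultimately show ?thesis using r by (simp add: complete_nonneg_metrics_def)
qed

section \<open>Shears act freely\<close>

text \<open>The inequality of Gronwall: \<open>d\<^sup>2 exp (- 2 C s)\<close> is nonincreasing.\<close>

lemma linear_growth_zero: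
  fixes d :: "real \<Rightarrow> real"
  assumes d: "\<And>s. s \<in> {0..R} \<Longrightarrow> (d has_field_derivative d' s) (at s)"
    and le: "\<And>s. s \<in> {0..R} \<Longrightarrow> \<bar>d' s\<bar> \<le> C * \<bar>d s\<bar>" and 0: "d 0 = 0" and R: "R \<ge> 0"
  shows "d R = 0"
proof -
  let ?f = "\<lambda>s. (d s)\<^sup>2 * exp (- (2 * C * s))"
  have "?f R \<le> ?f 0"
  proof (rule DERIV_nonpos_imp_nonincreasing[OF R])
    fix s assume s: "0 \<le> s" "s \<le> R"
    have "(?f has_field_derivative (2 * (d s * d' s) - 2 * C * (d s)\<^sup>2) * exp (- (2 * C * s))) (at s)"
      using s by (auto intro!: derivative_eq_intros d simp: algebra_simps power2_eq_square)
    moreover have "d s * d' s \<le> C * (d s)\<^sup>2"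
    proof -
      have "d s * d' s \<le> \<bar>d s\<bar> * \<bar>d' s\<bar>" by (metis abs_ge_self abs_mult)
      also have "\<dots> \<le> \<bar>d s\<bar> * (C * \<bar>d s\<bar>)" using le s by (intro mult_left_mono) auto
      finally show ?thesis by (simp add: power2_eq_square algebra_simps)
    qed
    ultimately show "\<exists>y. (?f has_field_derivative y) (at s) \<and> y \<le> 0"
      by (intro exI conjI) (auto simp: mult_nonpos_nonneg)
  qed
  then show ?thesis using 0 by (simp add: mult_le_0_iff)
qed

text \<open>Let \<open>F\<close> and \<open>G\<close> be the entries in the last column of \<open>g\<close>. On the line \<open>y = 0\<close> the last column of the two
equal matrices gives \<open>G (s, h) = G (s, k)\<close> and \<open>F (s, h) + h1 G (s, h) = F (s, k) + k1 G (s, k)\<close>, so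
\<open>h1 - k1 = (F (s, k) - F (s, h)) / G (s, h)\<close>. On compact sets \<open>F\<close> is Lipschitz in its second variable
and \<open>G\<close> is bounded below by a positive constant.\<close>

lemma sheared_metric_derivative_bound:
  assumes g: "riemannian_metric g"
    and h: "\<And>s. (h has_field_derivative h1 s) (at s)" and k: "\<And>s. (k has_field_derivative k1 s) (at s)"
    and eq: "sheared_metric h h1 g = sheared_metric k k1 g"
  shows "\<exists>C. \<forall>s\<in>{a..b}. \<bar>h1 s - k1 s\<bar> \<le> C * \<bar>h s - k s\<bar>"
proof -
  have sm: "smooth_function (\<lambda>x. g x $ i $ j)" for i j
    using g unfolding riemannian_metric_def by blast
  have hc: "continuous_on {a..b} h" and kc: "continuous_on {a..b} k"
    using h k by (meson DERIV_continuous continuous_at_imp_continuous_on)+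
  have "bounded (h ` {a..b} \<union> k ` {a..b})"
    using hc kc by (intro bounded_Un[THEN iffD2] conjI compact_imp_bounded compact_continuous_image) auto
  then obtain B where "\<forall>y\<in>h ` {a..b} \<union> k ` {a..b}. norm y \<le> B"
    unfolding bounded_iff by blast
  then have B: "\<And>s. s \<in> {a..b} \<Longrightarrow> \<bar>h s\<bar> \<le> B" "\<And>s. s \<in> {a..b} \<Longrightarrow> \<bar>k s\<bar> \<le> B"
    by auto
  define P :: "real \<Rightarrow> real \<Rightarrow> real ^ 2" where "P s y = vector [s, y]" for s y
  define S where "S = (\<lambda>(s, y). P s y) ` ({a..b} \<times> {-B..B})"
  have Pc: "continuous_on UNIV (\<lambda>(s, y). P s y)"
  proof -
    have "(\<lambda>(s, y). P s y) = (\<lambda>q. fst q *\<^sub>R axis 1 1 + snd q *\<^sub>R axis 2 1)"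
      by (auto simp: fun_eq_iff P_def vec_eq_iff forall_2 axis_def)
    then show ?thesis by (simp add: continuous_intros)
  qed
  have compS: "compact S"
    unfolding S_def by (intro compact_continuous_image continuous_on_subset[OF Pc] compact_Times) auto
  have mem: "P s y \<in> S" if "s \<in> {a..b}" "\<bar>y\<bar> \<le> B" for s y
    unfolding S_def using that by (intro image_eqI[of _ _ "(s, y)"]) auto
  let ?F = "\<lambda>x. g x $ 1 $ 2" and ?G = "\<lambda>x. g x $ 2 $ 2"
  have "bounded (partial_deriv 2 ?F ` S)"
    by (intro compact_imp_bounded compact_continuous_image compS smooth_function_continuous
        smooth_function_partial_deriv sm)
  then obtain N where "\<forall>y\<in>partial_deriv 2 ?F ` S. norm y \<le> N" unfolding bounded_iff by blast
  then have N: "\<And>x. x \<in> S \<Longrightarrow> \<bar>partial_deriv 2 ?F x\<bar> \<le> N" by auto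
  have "\<exists>m>0. \<forall>x\<in>S. m \<le> ?G x"
  proof (cases "S = {}")
    case False
    obtain x where "x \<in> S" "\<forall>y\<in>S. ?G x \<le> ?G y"
      using continuous_attains_inf[OF compS False smooth_function_continuous[OF sm]] by blast
    then show ?thesis using riemannian_metric_2(3)[OF g] by blast
  qed (auto intro: exI[of _ 1])
  then obtain m where m: "m > 0" "\<And>x. x \<in> S \<Longrightarrow> m \<le> ?G x" by blast
  have lip: "\<bar>?F (P s y) - ?F (P s y')\<bar> \<le> N * \<bar>y - y'\<bar>"
    if s: "s \<in> {a..b}" and y: "\<bar>y\<bar> \<le> B" "\<bar>y'\<bar> \<le> B" for s y y'
  proof -
    have d: "((\<lambda>y. ?F (P s y)) has_field_derivative partial_deriv 2 ?F (P s y)) (at y)" for y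
    proof -
      have "P s 0 + y *\<^sub>R axis 2 1 = P s y" for y
        by (simp add: P_def vec_eq_iff forall_2 axis_def)
      then show ?thesis
        using partial_deriv_along[OF smooth_function_differentiable[OF sm[of 1 2]], of "P s 0" 2 y] by simp
    qed
    have "norm (?F (P s y) - ?F (P s y')) \<le> N * norm (y - y')"
    proof (rule field_differentiable_bound[of "{-B..B}"])
      show "((\<lambda>y. ?F (P s y)) has_field_derivative partial_deriv 2 ?F (P s t)) (at t within {-B..B})" for t
        by (rule has_field_derivative_at_within[OF d])
      show "norm (partial_deriv 2 ?F (P s t)) \<le> N" if "t \<in> {-B..B}" for t
        using N[OF mem[OF s, of t]] that by auto
    qed (use y in auto)
    then show ?thesis by simp
  qed
  have "\<bar>h1 s - k1 s\<bar> \<le> N / m * \<bar>h s - k s\<bar>" if s: "s \<in> {a..b}" for s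
  proof -
    have sh: "shear h (P s 0) = P s (h s)" "shear k (P s 0) = P s (k s)"
      by (simp_all add: P_def vec_eq_iff forall_2)
    have P1: "P s 0 $ 1 = s" by (simp add: P_def)
    note e = fun_cong[OF eq, of "P s 0"]
    have G: "?G (P s (h s)) = ?G (P s (k s))"
      using arg_cong[OF e, of "\<lambda>A. A $ 2 $ 2"] unfolding sheared_metric_nth sh .
    have F: "?F (P s (h s)) + h1 s * ?G (P s (h s)) = ?F (P s (k s)) + k1 s * ?G (P s (k s))"
      using arg_cong[OF e, of "\<lambda>A. A $ 1 $ 2"] unfolding sheared_metric_nth sh P1 .
    have mG: "m \<le> ?G (P s (h s))" using m(2) mem[OF s] B(1)[OF s] by blast
    have "(h1 s - k1 s) * ?G (P s (h s)) = ?F (P s (k s)) - ?F (P s (h s))"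
      using F unfolding G by (simp add: algebra_simps)
    then have "\<bar>h1 s - k1 s\<bar> * ?G (P s (h s)) = \<bar>?F (P s (k s)) - ?F (P s (h s))\<bar>"
      using mG m(1) by (metis abs_mult abs_of_pos less_le_trans)
    also have "\<dots> \<le> N * \<bar>k s - h s\<bar>" using lip[OF s] B[OF s] by blast
    finally have "\<bar>h1 s - k1 s\<bar> * m \<le> N * \<bar>k s - h s\<bar>"
      using mult_left_mono[OF mG, of "\<bar>h1 s - k1 s\<bar>"] by linarith
    then show ?thesis using m(1) by (simp add: field_simps abs_minus_commute)
  qed
  then show ?thesis by blast
qed

text \<open>Two shears that agree over one vertical line and have the same effect on some metric coincide. The
Gronwall bound is run from \<open>z\<close> in both directions \<open>\<sigma> = 1\<close> and \<open>\<sigma> = -1\<close>.\<close>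

lemma sheared_metric_inject:
  assumes g: "riemannian_metric g"
    and h: "\<And>s. (h has_field_derivative h1 s) (at s)" and k: "\<And>s. (k has_field_derivative k1 s) (at s)"
    and eq: "sheared_metric h h1 g = sheared_metric k k1 g" and z: "h z = k z"
  shows "h = k"
proof
  fix s
  have "h (z + \<sigma> * \<bar>s - z\<bar>) - k (z + \<sigma> * \<bar>s - z\<bar>) = 0" if \<sigma>: "\<sigma> = 1 \<or> \<sigma> = -1" for \<sigma> :: real
  proof -
    let ?R = "\<bar>s - z\<bar>"
    obtain C where C: "\<And>r. r \<in> {z - ?R..z + ?R} \<Longrightarrow> \<bar>h1 r - k1 r\<bar> \<le> C * \<bar>h r - k r\<bar>"
      using sheared_metric_derivative_bound[OF g h k eq, of "z - ?R" "z + ?R"] by blast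
    show ?thesis
    proof (rule linear_growth_zero[where d = "\<lambda>r. h (z + \<sigma> * r) - k (z + \<sigma> * r)"
          and d' = "\<lambda>r. \<sigma> * (h1 (z + \<sigma> * r) - k1 (z + \<sigma> * r))" and C = C])
      show "((\<lambda>r. h (z + \<sigma> * r) - k (z + \<sigma> * r)) has_field_derivative
          \<sigma> * (h1 (z + \<sigma> * r) - k1 (z + \<sigma> * r))) (at r)" for r
      proof -
        have l: "((\<lambda>r. z + \<sigma> * r) has_field_derivative \<sigma>) (at r)" by (auto intro!: derivative_eq_intros)
        show ?thesis
          using DERIV_diff[OF DERIV_chain2[OF h l] DERIV_chain2[OF k l]] by (simp add: algebra_simps)
      qed
      show "\<bar>\<sigma> * (h1 (z + \<sigma> * r) - k1 (z + \<sigma> * r))\<bar> \<le> C * \<bar>h (z + \<sigma> * r) - k (z + \<sigma> * r)\<bar>"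
        if "r \<in> {0..?R}" for r
        using \<sigma> C[of "z + \<sigma> * r"] that by (auto simp: abs_minus_commute)
    qed (use z in auto)
  qed
  from this[of 1] this[of "-1"] show "h s = k s" by (auto simp: abs_if split: if_splits)
qed

section \<open>A path between two metrics\<close>

text \<open>Polarization with the vectors \<open>e\<^sub>1\<close>, \<open>e\<^sub>2\<close> and \<open>e\<^sub>1 + e\<^sub>2\<close>.\<close>

lemma riemannian_metric_eqI:
  fixes g h :: "2 metric_field"
  assumes g: "riemannian_metric g" and h: "riemannian_metric h"
    and eq: "\<And>x v. metric_inner g x v v = metric_inner h x v v"
  shows "g = h"
proof
  fix x
  have "g x $ i $ j = h x $ i $ j" for i j
    using eq[of x "axis 1 1"] eq[of x "axis 2 1"] eq[of x "axis 1 1 + axis 2 1"]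
      exhaust_2[of i] exhaust_2[of j]
    unfolding metric_inner_2 riemannian_metric_2(1)[OF g] riemannian_metric_2(1)[OF h]
    by (auto simp: axis_def riemannian_metric_2(1)[OF g] riemannian_metric_2(1)[OF h])
  then show "g x = h x" by (simp add: vec_eq_iff)
qed

text \<open>The factor that turns the squared length \<open>(1 - m) a + m b\<close> of the marked vector along the unnormalized
path into the affine function \<open>(1 - s) a + s b\<close>.\<close>

definition path_coeff :: "real \<Rightarrow> real \<Rightarrow> real \<Rightarrow> real"
  where "path_coeff a b s = (let m = max 0 (min 1 (3 * s - 1)) in
    ((1 - s) * a + s * b) / ((1 - m) * a + m * b))"

text \<open>One formula for the three stages: on \<open>s \<le> 1/3\<close> the weight \<open>m\<close> of \<open>g2\<close> is 0 and \<open>g1\<close> is zoomed to the constant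
\<open>g1 z\<close>; on \<open>1/3 \<le> s \<le> 2/3\<close> both zoom factors are 0 and \<open>m\<close> runs from 0 to 1; on \<open>s \<ge> 2/3\<close> the weight is 1
and \<open>g2\<close> is zoomed out from the constant \<open>g2 z\<close>.\<close>

definition metric_path :: "2 metric_field \<Rightarrow> 2 metric_field \<Rightarrow> real ^ 2 \<Rightarrow> real ^ 2 \<Rightarrow> real \<Rightarrow> 2 metric_field"
  where "metric_path g1 g2 z v s x = (let m = max 0 (min 1 (3 * s - 1)) in
    path_coeff (metric_inner g1 z v v) (metric_inner g2 z v v) s *\<^sub>R
     ((1 - m) *\<^sub>R g1 (z + max 0 (1 - 3 * s) *\<^sub>R (x - z)) + m *\<^sub>R g2 (z + max 0 (3 * s - 2) *\<^sub>R (x - z))))"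

lemma convex_combination_pos:
  fixes a b m :: real
  assumes "a > 0" "b > 0" "0 \<le> m" "m \<le> 1"
  shows "(1 - m) * a + m * b > 0"
  using assms by (cases "m = 1") (auto intro: add_pos_nonneg)

lemma path_coeff_pos:
  assumes "a > 0" "b > 0" "0 \<le> s" "s \<le> 1"
  shows "path_coeff a b s > 0"
  unfolding path_coeff_def Let_def using assms
  by (intro divide_pos_pos convex_combination_pos) auto

lemma metric_inner_combination:
  "metric_inner (\<lambda>x. c *\<^sub>R (a *\<^sub>R A x + b *\<^sub>R B x)) x u v = c * (a * metric_inner A x u v + b * metric_inner B x u v)"
  unfolding metric_inner_eq_sum by (simp add: sum_distrib_left sum.distrib algebra_simps)

lemma metric_path_value:
  assumes g: "riemannian_metric g1" "riemannian_metric g2" and v: "v \<noteq> 0"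
  shows "metric_inner (metric_path g1 g2 z v s) z v v = (1 - s) * metric_inner g1 z v v + s * metric_inner g2 z v v"
proof -
  define m where "m = max 0 (min 1 (3 * s - 1))"
  let ?a = "metric_inner g1 z v v" and ?b = "metric_inner g2 z v v"
  have "(1 - m) * ?a + m * ?b > 0"
    by (intro convex_combination_pos riemannian_metric_pos g v) (auto simp: m_def)
  moreover have "metric_inner (metric_path g1 g2 z v s) z v v = path_coeff ?a ?b s * ((1 - m) * ?a + m * ?b)"
    unfolding metric_path_def Let_def m_def metric_inner_combination by (simp add: metric_inner_def)
  ultimately show ?thesis
    unfolding path_coeff_def Let_def m_def[symmetric] by simp
qed

lemma metric_path_endpoints:
  assumes g: "riemannian_metric g1" "riemannian_metric g2" and v: "v \<noteq> 0"
  shows "metric_path g1 g2 z v 0 = g1" "metric_path g1 g2 z v 1 = g2"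
proof -
  have "metric_inner g1 z v v > 0" "metric_inner g2 z v v > 0"
    using g v by (auto intro: riemannian_metric_pos)
  then show "metric_path g1 g2 z v 0 = g1" "metric_path g1 g2 z v 1 = g2"
    by (simp_all add: fun_eq_iff metric_path_def path_coeff_def)
qed

text \<open>Sums of nonnegatively curved metrics need not be nonnegatively curved; here the two summands are both
present only while they are constant.\<close>

lemma metric_path_complete_nonneg:
  assumes g: "g1 \<in> complete_nonneg_metrics" "g2 \<in> complete_nonneg_metrics" and v: "v \<noteq> 0"
    and s: "0 \<le> s" "s \<le> 1"
  shows "metric_path g1 g2 z v s \<in> complete_nonneg_metrics"
proof -
  have r: "riemannian_metric g1" "riemannian_metric g2"
    using g by (auto simp: complete_nonneg_metrics_def)
  define c where "c = path_coeff (metric_inner g1 z v v) (metric_inner g2 z v v) s"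
  have c: "c > 0"
    unfolding c_def by (intro path_coeff_pos s riemannian_metric_pos r v)
  consider "s < 1/3" | "s > 2/3" | "1/3 \<le> s" "s \<le> 2/3" by linarith
  then show ?thesis
  proof cases
    case 1
    then have "metric_path g1 g2 z v s = zoomed_metric c z (1 - 3 * s) g1"
      by (simp add: fun_eq_iff metric_path_def zoomed_metric_def c_def)
    then show ?thesis using zoomed_metric_complete_nonneg[OF g(1) c] 1 by simp
  next
    case 2
    then have "metric_path g1 g2 z v s = zoomed_metric c z (3 * s - 2) g2"
      by (simp add: fun_eq_iff metric_path_def zoomed_metric_def c_def)
    then show ?thesis using zoomed_metric_complete_nonneg[OF g(2) c] 2 by simp
  next
    case 3
    define m where "m = 3 * s - 1"
    have m: "0 \<le> m" "m \<le> 1" "max 0 (min 1 (3 * s - 1)) = m" using 3 by (auto simp: m_def)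
    have eq: "metric_path g1 g2 z v s = (\<lambda>x. c *\<^sub>R ((1 - m) *\<^sub>R g1 z + m *\<^sub>R g2 z))"
      unfolding metric_path_def Let_def m(3) using 3 by (simp add: fun_eq_iff c_def)
    have i: "metric_inner (\<lambda>x. c *\<^sub>R ((1 - m) *\<^sub>R g1 z + m *\<^sub>R g2 z)) x u w
        = c * ((1 - m) * metric_inner g1 z u w + m * metric_inner g2 z u w)" for x u w
      using metric_inner_combination[of c "1 - m" "\<lambda>x. g1 z" m "\<lambda>x. g2 z" x u w]
      by (simp add: metric_inner_def)
    have "riemannian_metric (\<lambda>x. c *\<^sub>R ((1 - m) *\<^sub>R g1 z + m *\<^sub>R g2 z))"
      unfolding riemannian_metric_def i
    proof (intro conjI allI impI)
      show "smooth_function (\<lambda>x. (c *\<^sub>R ((1 - m) *\<^sub>R g1 z + m *\<^sub>R g2 z)) $ i $ j)" for i j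
        by (rule smooth_family_smooth_function[OF smooth_family_const])
      show "c * ((1 - m) * metric_inner g1 z u w + m * metric_inner g2 z u w)
          = c * ((1 - m) * metric_inner g1 z w u + m * metric_inner g2 z w u)" for u w
        using riemannian_metric_symmetric[OF r(1), of z u w] riemannian_metric_symmetric[OF r(2), of z u w] by simp
      show "c * ((1 - m) * metric_inner g1 z w w + m * metric_inner g2 z w w) > 0" if "w \<noteq> 0" for w
        by (intro mult_pos_pos c convex_combination_pos riemannian_metric_pos r m that)
    qed
    then show ?thesis unfolding eq by (rule constant_metric_complete_nonneg)
  qed
qed

lemma smooth_family_metric_path:
  fixes s :: "'p::topological_space \<Rightarrow> real"
  assumes r: "riemannian_metric g1" "riemannian_metric g2" and v: "v \<noteq> 0"
    and s: "continuous_on UNIV s"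
  shows "smooth_family (\<lambda>p x. metric_path g1 g2 z v (s p) x $ i $ j)"
proof -
  let ?a = "metric_inner g1 z v v" and ?b = "metric_inner g2 z v v"
  have sm: "smooth_function (\<lambda>x. g1 x $ i $ j)" "smooth_function (\<lambda>x. g2 x $ i $ j)"
    using r unfolding riemannian_metric_def by blast+
  define m where "m p = max 0 (min 1 (3 * s p - 1))" for p
  have "(1 - m p) * ?a + m p * ?b > 0" for p
    by (intro convex_combination_pos riemannian_metric_pos r v) (auto simp: m_def)
  then have ne: "(1 - m p) * ?a + m p * ?b \<noteq> 0" for p by (metis less_irrefl)
  have m: "continuous_on UNIV m" unfolding m_def by (intro continuous_intros s)
  have "continuous_on UNIV (\<lambda>p. path_coeff ?a ?b (s p))"
    unfolding path_coeff_def Let_def m_def[symmetric]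
    by (intro continuous_intros s m ballI ne)
  then have "smooth_family (\<lambda>p x. path_coeff ?a ?b (s p) *
     ((1 - m p) * g1 (z + max 0 (1 - 3 * s p) *\<^sub>R (x - z)) $ i $ j
       + m p * g2 (z + max 0 (3 * s p - 2) *\<^sub>R (x - z)) $ i $ j))"
    by (intro smooth_family_mult smooth_family_add smooth_family_parameter smooth_family_zoom sm
        continuous_intros s m)
  then show ?thesis unfolding metric_path_def Let_def m_def by simp
qed

section \<open>The Hilbert cube\<close>

definition hilbert_cube :: "(nat \<Rightarrow> real) set"
  where "hilbert_cube = {q. \<forall>n. q n \<in> {0..1}}"

lemma compact_hilbert_cube: "compact hilbert_cube"
proof -
  have "compactin (product_topology (\<lambda>n. euclidean) UNIV) (PiE UNIV (\<lambda>n::nat. {0..1::real}))"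
    unfolding compactin_PiE by simp
  moreover have "PiE UNIV (\<lambda>n::nat. {0..1::real}) = hilbert_cube"
    by (auto simp: hilbert_cube_def PiE_def Pi_def)
  ultimately show ?thesis by (simp add: euclidean_product_topology)
qed

text \<open>The coordinates are the distances, truncated at 1, to the points of a countable dense set. A dense point
near \<open>x\<close> shows that nearby coordinates force nearby points, which gives openness and injectivity alike.\<close>

lemma separable_metrizable_embeds_hilbert_cube:
  assumes "separable_space X" "metrizable_space X" "topspace X \<noteq> {}"
  shows "\<exists>e. embedding_map X (top_of_set hilbert_cube) e"
proof -
  obtain M d where Md: "Metric_space M d" and X: "X = Metric_space.mtopology M d"
    using assms(2) unfolding metrizable_space_def by blast
  interpret Metric_space M d by fact
  have top: "topspace X = M" using X by simp
  obtain C where C: "countable C" "C \<subseteq> M" "X closure_of C = M"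
    using assms(1) top unfolding separable_space_def by auto
  have "C \<noteq> {}" using C(3) assms(3) top by auto
  define s where "s = from_nat_into C"
  have s: "s n \<in> M" for n using from_nat_into[OF \<open>C \<noteq> {}\<close>] C(2) by (auto simp: s_def)
  have dense: "\<exists>n. d x (s n) < r" if "x \<in> M" "r > 0" for x r
  proof -
    have "x \<in> mtopology closure_of C" using that C(3) X by simp
    then obtain y where "y \<in> C" "d x y < r"
      using \<open>r > 0\<close> unfolding metric_closure_of by auto
    then show ?thesis using from_nat_into_surj[OF C(1)] unfolding s_def by blast
  qed
  define e where "e x n = min 1 (d x (s n))" for x n
  have cube: "e ` M \<subseteq> hilbert_cube" by (auto simp: e_def hilbert_cube_def)
  have "continuous_map X euclideanreal (\<lambda>x. d x (s n))" for n
  proof -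
    have "continuous_map mtopology euclideanreal (\<lambda>x. mdist (metric (M, d)) x (s n))"
      by (rule continuous_map_mdist) (use s in \<open>auto simp: mtopology_of_def Metric_space_axioms\<close>)
    then show ?thesis using X by (simp add: Metric_space_axioms)
  qed
  then have "continuous_map X euclideanreal (\<lambda>x. e x n)" for n
    unfolding e_def by (intro continuous_intros) auto
  then have "continuous_map X (product_topology (\<lambda>n. euclideanreal) UNIV) e"
    by (simp add: continuous_map_componentwise_UNIV)
  then have cont: "continuous_map X (top_of_set (e ` M)) e"
    using top by (auto simp: euclidean_product_topology continuous_map_in_subtopology)
  have open_image: "\<exists>V. open V \<and> e x \<in> V \<and> (\<forall>y\<in>M. e y \<in> V \<longrightarrow> y \<in> U)"
    if U: "openin X U" and x: "x \<in> U" for U x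
  proof -
    obtain r where r: "r > 0" "mball x r \<subseteq> U"
      using U x unfolding X openin_mtopology by blast
    have xM: "x \<in> M" using U x openin_subset top by blast
    define r' where "r' = min 1 r"
    have r': "r' > 0" "r' \<le> 1" "r' \<le> r" using r by (auto simp: r'_def)
    obtain n where n: "d x (s n) < r' / 2" using dense[OF xM, of "r' / 2"] r' by auto
    let ?V = "{w :: nat \<Rightarrow> real. w n < r' / 2}"
    have "open ?V" by (intro open_Collect_less continuous_intros) auto
    moreover have "e x \<in> ?V" using n by (simp add: e_def)
    moreover have "y \<in> U" if y: "y \<in> M" "e y \<in> ?V" for y
    proof -
      have "d y (s n) < r' / 2" using y(2) r'(2) by (auto simp: e_def min_def split: if_splits)
      then have "d x y < r" using n triangle'[OF xM s y(1), of n] r'(3) commute by force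
      then show ?thesis using r(2) xM y(1) by auto
    qed
    ultimately show ?thesis by blast
  qed
  have inj: "inj_on e M"
  proof (rule inj_onI, rule ccontr)
    fix x y assume xy: "x \<in> M" "y \<in> M" "e x = e y" "x \<noteq> y"
    then have "openin X (mball x (d x y))" "x \<in> mball x (d x y)" unfolding X by auto
    from open_image[OF this] xy have "y \<in> mball x (d x y)" by metis
    then show False by simp
  qed
  have "open_map X (top_of_set (e ` M)) e"
    unfolding open_map_def
  proof (intro allI impI)
    fix U assume U: "openin X U"
    then have UM: "U \<subseteq> M" using openin_subset top by blast
    show "openin (top_of_set (e ` M)) (e ` U)"
    proof (subst openin_subopen, intro ballI)
      fix w assume "w \<in> e ` U"
      then obtain x where x: "x \<in> U" "w = e x" by blast
      obtain V where "open V" "e x \<in> V" "\<forall>y\<in>M. e y \<in> V \<longrightarrow> y \<in> U"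
        using open_image[OF U x(1)] by blast
      then show "\<exists>T. openin (top_of_set (e ` M)) T \<and> w \<in> T \<and> T \<subseteq> e ` U"
        using x UM by (intro exI[of _ "e ` M \<inter> V"]) (auto simp: openin_open_Int)
    qed
  qed
  then have "embedding_map X euclidean e"
    unfolding embedding_map_def
    using bijective_open_imp_homeomorphic_map[OF cont] inj top by simp
  then have "embedding_map X (top_of_set hilbert_cube) e"
    using cube top by (simp add: embedding_map_in_subtopology)
  then show ?thesis by blast
qed

section \<open>Embeddings avoiding a countable set\<close>

text \<open>The map sends \<open>q\<close> to the metric at parameter \<open>\<tau> q\<close> of the path, sheared by a function \<open>H c 0 q\<close> of the
first coordinate. The squared length of \<open>v\<close> at \<open>z\<close> determines \<open>\<tau> q\<close>, hence the metric before
shearing; freeness of the shears then determines the function, hence its Taylor coefficients, which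
contain \<open>c\<close> and the coordinates of \<open>q\<close> unless \<open>\<tau> q\<close> is 0 or 1.\<close>

lemma hilbert_cube_embedding_avoiding:
  fixes g1 g2 :: "2 metric_field"
  assumes K: "countable K"
    and g1: "g1 \<in> complete_nonneg_metrics - K" and g2: "g2 \<in> complete_nonneg_metrics - K" and ne: "g1 \<noteq> g2"
    and p: "p1 \<noteq> p2"
  shows "\<exists>f. embedding_map (top_of_set hilbert_cube)
       (subtopology (Ck_topology k complete_nonneg_metrics) (complete_nonneg_metrics - K)) f
     \<and> f p1 = g1 \<and> f p2 = g2"
proof -
  have r: "riemannian_metric g1" "riemannian_metric g2"
    using g1 g2 by (auto simp: complete_nonneg_metrics_def)
  obtain z v where zv: "metric_inner g1 z v v \<noteq> metric_inner g2 z v v"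
    using riemannian_metric_eqI[OF r] ne by blast
  have v: "v \<noteq> 0" using zv by (auto simp: metric_inner_def)
  define \<tau> where "\<tau> q = dist q p1 / (dist q p1 + dist q p2)" for q :: "nat \<Rightarrow> real"
  have den: "dist q p1 + dist q p2 > 0" for q
    using p by (metis add_nonneg_eq_0_iff dist_eq_0_iff less_le zero_le_dist add_nonneg_nonneg)
  have \<tau>c: "continuous_on UNIV \<tau>"
    unfolding \<tau>_def by (intro continuous_intros) (use den in \<open>auto simp: less_imp_neq[symmetric]\<close>)
  have \<tau>: "0 \<le> \<tau> q" "\<tau> q \<le> 1" for q using den[of q] by (auto simp: \<tau>_def)
  have \<tau>0: "\<tau> q = 0 \<longleftrightarrow> q = p1" for q using den[of q] by (simp add: \<tau>_def)
  have \<tau>1: "\<tau> q = 1 \<longleftrightarrow> q = p2" for q using den[of q] by (simp add: \<tau>_def)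
  \<comment> \<open>The first two coefficients vanish so that the shear fixes \<open>z\<close> to first order; the third is the free parameter. Clamping makes the coefficients bounded for all sequences, not only on the cube.\<close>
  define b where "b c n q = (if n < 2 then 0 else \<tau> q * (1 - \<tau> q) *
      (if n = 2 then c else max 0 (min 1 (q (n - 3)))))" for c :: real and n q
  have bc: "continuous_on UNIV (b c n)" for c n
    unfolding b_def by (cases "n < 2"; cases "n = 2"; simp) (intro continuous_intros \<tau>c continuous_on_product_coordinates)+
  have bb: "\<bar>b c n q\<bar> \<le> 1" if "c \<in> {0..1}" for c n q
  proof -
    have "\<bar>\<tau> q * (1 - \<tau> q) * u\<bar> \<le> 1 * 1 * 1" if "0 \<le> u" "u \<le> 1" for u
      unfolding abs_mult using \<tau>[of q] that by (intro mult_mono) auto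
    then show ?thesis using that by (auto simp: b_def)
  qed
  \<comment> \<open>\<open>H c l q\<close> is the \<open>l\<close>-th derivative of the shearing function.\<close>
  define H where "H c l q y = exp_series (\<lambda>n. b c (n + l) q) (y - z $ 1)" for c l q y
  have H: "(H c l q has_field_derivative H c (Suc l) q y) (at y)" if c: "c \<in> {0..1}" for c l q y
  proof -
    have l: "((\<lambda>y. y - z $ 1) has_field_derivative 1) (at y)" by (auto intro!: derivative_eq_intros)
    show ?thesis
      using DERIV_chain2[OF exp_series_has_derivative[of "\<lambda>n. b c (n + l) q", OF bb[OF c]] l]
      by (simp add: H_def[abs_def])
  qed
  have H_smooth: "smooth_family (\<lambda>q x. H c l q (x $ 1))" if c: "c \<in> {0..1}" for c l
    unfolding H_def by (intro smooth_family_exp_series bc bb c)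
  have H0: "H c 0 q (z $ 1) = 0" "H c 1 q (z $ 1) = 0" for c q
    by (simp_all add: H_def exp_series_0 b_def)
  define f where "f c q = sheared_metric (H c 0 q) (H c 1 q) (metric_path g1 g2 z v (\<tau> q))" for c q
  have path: "metric_path g1 g2 z v (\<tau> q) \<in> complete_nonneg_metrics" for q
    using g1 g2 v \<tau> by (intro metric_path_complete_nonneg) auto
  have path_r: "riemannian_metric (metric_path g1 g2 z v (\<tau> q))" for q
    using path by (simp add: complete_nonneg_metrics_def)
  have f_smooth: "smooth_family (\<lambda>q x. f c q x $ i $ j)" if c: "c \<in> {0..1}" for c i j
    unfolding f_def
    by (intro smooth_family_sheared_metric smooth_family_metric_path r v \<tau>c H_smooth c)
  have f_mem: "f c q \<in> complete_nonneg_metrics" if c: "c \<in> {0..1}" for c q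
    unfolding f_def
  proof (rule sheared_metric_complete_nonneg[OF path])
    show "smooth_function (\<lambda>x. sheared_metric (H c 0 q) (H c 1 q) (metric_path g1 g2 z v (\<tau> q)) x $ i $ j)" for i j
      using smooth_family_smooth_function[OF f_smooth[OF c]] unfolding f_def .
  qed (use H[OF c, of 0 q] H[OF c, of 1 q] in simp_all)
  have b0: "b c n q = 0" if "\<tau> q = 0 \<or> \<tau> q = 1" for c n q
    using that by (auto simp: b_def)
  have f_ends: "f c p1 = g1" "f c p2 = g2" for c
  proof -
    have \<tau>p: "\<tau> p1 = 0" "\<tau> p2 = 1" using \<tau>0 \<tau>1 by auto
    have "H c l p1 s = 0" "H c l p2 s = 0" for l s
      unfolding H_def using b0 \<tau>p by (simp_all add: exp_series_def)
    then show "f c p1 = g1" "f c p2 = g2"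
      unfolding f_def \<tau>p metric_path_endpoints[OF r v] by (simp_all add: sheared_metric_0 r)
  qed
  have f_value: "metric_inner (f c q) z v v = (1 - \<tau> q) * metric_inner g1 z v v + \<tau> q * metric_inner g2 z v v" for c q
  proof -
    have "shear (H c 0 q) z = z" by (simp add: vec_eq_iff forall_2 H0)
    then show ?thesis
      unfolding f_def metric_inner_sheared[OF path_r] H0 by (simp add: metric_path_value[OF r v])
  qed
  have f_inj: "q = q' \<and> (c = c' \<or> q \<in> {p1, p2})"
    if c: "c \<in> {0..1}" and c': "c' \<in> {0..1}" and q: "q \<in> hilbert_cube" "q' \<in> hilbert_cube" and eq: "f c q = f c' q'"
    for c c' q q'
  proof -
    have "(\<tau> q - \<tau> q') * (metric_inner g2 z v v - metric_inner g1 z v v) = 0"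
      using f_value[of c q] f_value[of c' q'] eq by (simp add: algebra_simps)
    then have \<tau>eq: "\<tau> q = \<tau> q'" using zv by simp
    show ?thesis
    proof (cases "\<tau> q = 0 \<or> \<tau> q = 1")
      case True
      then show ?thesis using \<tau>eq \<tau>0 \<tau>1 by (metis insertCI)
    next
      case False
      then have pos: "\<tau> q * (1 - \<tau> q) \<noteq> 0" by auto
      have "H c 0 q = H c' 0 q'"
      proof (rule sheared_metric_inject[OF path_r])
        show "(H c 0 q has_field_derivative H c 1 q s) (at s)" "(H c' 0 q' has_field_derivative H c' 1 q' s) (at s)" for s
          using H[OF c, of 0 q s] H[OF c', of 0 q' s] by simp_all
        show "sheared_metric (H c 0 q) (H c 1 q) (metric_path g1 g2 z v (\<tau> q))
            = sheared_metric (H c' 0 q') (H c' 1 q') (metric_path g1 g2 z v (\<tau> q))"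
          using eq unfolding f_def \<tau>eq .
        show "H c 0 q (z $ 1) = H c' 0 q' (z $ 1)" by (simp add: H0)
      qed
      then have "H c 0 q (y + z $ 1) = H c' 0 q' (y + z $ 1)" for y by simp
      then have "exp_series (\<lambda>n. b c n q) = exp_series (\<lambda>n. b c' n q')"
        unfolding H_def by (simp add: fun_eq_iff)
      then have beq: "(\<lambda>n. b c n q) = (\<lambda>n. b c' n q')"
        by (intro exp_series_inject bb c c')
      have "c = c'" using fun_cong[OF beq, of 2] pos \<tau>eq by (simp add: b_def)
      moreover have "q n = q' n" for n
      proof -
        have "max 0 (min 1 (q n)) = max 0 (min 1 (q' n))"
          using fun_cong[OF beq, of "n + 3"] pos \<tau>eq by (simp add: b_def)
        moreover have "q n \<in> {0..1}" "q' n \<in> {0..1}"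
          using q unfolding hilbert_cube_def by blast+
        ultimately show ?thesis by simp
      qed
      ultimately show ?thesis by auto
    qed
  qed
  have "\<exists>c\<in>{0..1}. \<forall>q\<in>hilbert_cube. f c q \<notin> K"
  proof (rule ccontr)
    assume "\<not> ?thesis"
    then obtain w where w: "\<And>c. c \<in> {0..1} \<Longrightarrow> w c \<in> hilbert_cube \<and> f c (w c) \<in> K" by metis
    \<comment> \<open>Distinct parameters would hit \<open>K\<close> in distinct metrics, making \<open>[0, 1]\<close> countable.\<close>
    have "inj_on (\<lambda>c. f c (w c)) {0..1}"
    proof (rule inj_onI)
      fix c c' assume c: "c \<in> {0..1::real}" "c' \<in> {0..1}" "f c (w c) = f c' (w c')"
      have "w c \<notin> {p1, p2}" using w[OF c(1)] f_ends g1 g2 by auto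
      then show "c = c'" using f_inj[OF c(1,2) _ _ c(3)] w c(1,2) by blast
    qed
    moreover have "countable ((\<lambda>c. f c (w c)) ` {0..1})"
      using w by (intro countable_subset[OF _ K]) auto
    ultimately have "countable {0..1::real}" using countable_image_inj_on by blast
    then show False using uncountable_closed_interval[of 0 "1::real"] by simp
  qed
  then obtain c where c: "c \<in> {0..1}" and cK: "\<And>q. q \<in> hilbert_cube \<Longrightarrow> f c q \<notin> K" by blast
  have cont: "continuous_map (top_of_set hilbert_cube) (Ck_topology k complete_nonneg_metrics) (f c)"
    using f_mem[OF c] by (intro continuous_map_into_Ck_topology f_smooth c) auto
  have "closed_map (top_of_set hilbert_cube) (Ck_topology k complete_nonneg_metrics) (f c)"
    by (intro continuous_imp_closed_map_gen cont Hausdorff_imp_kc_space Hausdorff_space_Ck_topology)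
       (simp add: compact_space_subtopology compact_hilbert_cube)
  moreover have "inj_on (f c) (topspace (top_of_set hilbert_cube))"
    using f_inj[OF c c] by (auto intro: inj_onI)
  ultimately have "embedding_map (top_of_set hilbert_cube) (Ck_topology k complete_nonneg_metrics) (f c)"
    by (intro injective_closed_imp_embedding_map cont)
  then have "embedding_map (top_of_set hilbert_cube)
      (subtopology (Ck_topology k complete_nonneg_metrics) (complete_nonneg_metrics - K)) (f c)"
    using f_mem[OF c] cK by (auto simp: embedding_map_in_subtopology)
  then show ?thesis using f_ends by blast
qed

theorem theorem1p4:
  fixes k :: enat
    and K :: "(real ^ 2 \<Rightarrow> real ^ 2 ^ 2) set"
    and g1 g2 :: "real ^ 2 \<Rightarrow> real ^ 2 ^ 2"
    and X :: "'a topology"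
    and x1 x2 :: 'a
  assumes "countable K" and "K \<subseteq> complete_nonneg_metrics"
    and "separable_space X" and "metrizable_space X"
    and "x1 \<in> topspace X" and "x2 \<in> topspace X" and "x1 \<noteq> x2"
    and "g1 \<in> complete_nonneg_metrics - K" and "g2 \<in> complete_nonneg_metrics - K" and "g1 \<noteq> g2"
  shows "\<exists>f. embedding_map X
               (subtopology (Ck_topology k complete_nonneg_metrics) (complete_nonneg_metrics - K)) f
             \<and> f x1 = g1 \<and> f x2 = g2"
proof -
  obtain e where e: "embedding_map X (top_of_set hilbert_cube) e"
    using separable_metrizable_embeds_hilbert_cube[OF assms(3,4)] assms(5) by blast
  have "e x1 \<noteq> e x2"
    using e assms(5-7) by (auto simp: embedding_map_def homeomorphic_eq_everything_map dest: inj_onD)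
  from hilbert_cube_embedding_avoiding[OF assms(1,8-10) this]
  obtain f where "embedding_map (top_of_set hilbert_cube)
      (subtopology (Ck_topology k complete_nonneg_metrics) (complete_nonneg_metrics - K)) f"
    "f (e x1) = g1" "f (e x2) = g2" by blast
  then show ?thesis
    using embedding_map_compose[OF e] by (intro exI[of _ "f \<circ> e"]) simp
qed

end
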